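(* Let $\{A_j\}_{j\in\mathbb J}\in\mathscr F$. For all $\{B_j\}_{j\in\mathbb J}\in\mathscr F$ define $$\Phi_A(\{B_j\}_{j\in\mathbb J}):=\theta_BS_A^{-1}\theta_A^*.$$ Then $\Phi_A:\mathscr F\to\mathscr M_A$ is one-to-one and onto, and $\Phi_A^{-1}(M)=\{L_j^*M\theta_A\}_{j\in\mathbb J}$ for all $M\in\mathscr M_A$. If $\{B_j\}_{j\in\mathbb J}\in\mathscr F$ and $M:=\Phi_A(\{B_j\}_{j\in\mathbb J})$, then $\theta_B=M\theta_A$ and $$V_M:=M(M^*M)^{-1/2}$$ is a partial isometry that implements the equivalence $P_B\sim P_A$, i.e., $P_B=V_MV_M^*$ and $P_A=V_M^*V_M$.
   Context: Fix Hilbert spaces $H,H_o$ and an index set $\mathbb J$. $\mathscr F$ is the set of operator-valued frames on $H$ with range in $H_o$ indexed by $\mathbb J$: families $\{A_j\}_{j\in\mathbb J}\subset B(H,H_o)$ such that $S_A:=\sum_{j}A_j^*A_j$ converges in the strong operator topology (net of finite partial sums) to a bounded positive invertible operator. $L_j:H_o\to\ell^2(\mathbb J)\otimes H_o$ is $L_jh=e_j\otimes h$, with $\{e_j\}$ the standard basis of $\ell^2(\mathbb J)$. The analysis operator is $\theta_A:=\sum_jL_jA_j\in B(H,\ell^2(\mathbb J)\otimes H_o)$ (strong convergence); $S_A=\theta_A^*\theta_A$; the frame projection $P_A:=\theta_AS_A^{-1}\theta_A^*$ is the range projection of $\theta_A$. Define $$\mathscr M_A:=\{M\in B(\ell^2(\mathbb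 J)\otimes H_o)\mid M=MP_A,\ M^*M|_{P_A(\ell^2(\mathbb J)\otimes H_o)}\text{ is invertible in }B(P_A(\ell^2(\mathbb J)\otimes H_o))\}.$$ For $M\in\mathscr M_A$, $(M^*M)^{-1}$ denotes the inverse of $M^*M|_{P_A(\ell^2(\mathbb J)\otimes H_o)}$ in $B(P_A(\ell^2(\mathbb J)\otimes H_o))$ (extended by $0$ on the orthogonal complement when regarded as an operator on $\ell^2(\mathbb J)\otimes H_o$), and similarly for $(M^*M)^{-1/2}$. *)

theory Defs
  imports "HOL-Analysis.Analysis"
begin

section \<open>Complex Hilbert spaces\<close>

text \<open>
  The distribution only has real inner product spaces. A complex Hilbert space is a complete real
  inner product space with a compatible complex structure: the real inner product is the real part
  of the complex one, so norm and topology are the ones of the complex inner product, which is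
  linear in its first argument.
\<close>

class chilbert_space = real_inner + complete_space +
  fixes scaleC :: "complex \<Rightarrow> 'a \<Rightarrow> 'a" (infixr \<open>*\<^sub>C\<close> 75)
    and cinner :: "'a \<Rightarrow> 'a \<Rightarrow> complex"
  assumes scaleC_add_right: "a *\<^sub>C (x + y) = a *\<^sub>C x + a *\<^sub>C y"
    and scaleC_add_left: "(a + b) *\<^sub>C x = a *\<^sub>C x + b *\<^sub>C x"
    and scaleC_scaleC: "a *\<^sub>C b *\<^sub>C x = (a * b) *\<^sub>C x"
    and scaleR_scaleC: "r *\<^sub>R x = complex_of_real r *\<^sub>C x"
    and cinner_commute: "cinner x y = cnj (cinner y x)"
    and cinner_add_left: "cinner (x + y) z = cinner x z + cinner y z"
    and cinner_scaleC_left: "cinner (a *\<^sub>C x) y = a * cinner x y"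
    and inner_eq_Re_cinner: "inner x y = Re (cinner x y)"

lemma cinner_self: "cinner x x = complex_of_real ((norm x)\<^sup>2)"
proof -
  have "Im (cinner x x) = 0"
    using arg_cong[OF cinner_commute[of x x], of Im] by simp
  then show ?thesis
    by (simp add: complex_eq_iff power2_norm_eq_inner inner_eq_Re_cinner)
qed

lemma scaleC_zero_right [simp]: "a *\<^sub>C (0 :: 'a :: chilbert_space) = 0"
  using scaleC_add_right[of a "0 :: 'a" 0] by simp

lemma scaleC_zero_left [simp]: "0 *\<^sub>C (x :: 'a :: chilbert_space) = 0"
  using scaleC_add_left[of 0 0 x] by simp

lemma cinner_zero_left [simp]: "cinner 0 (y :: 'a :: chilbert_space) = 0"
  using cinner_add_left[of "0 :: 'a" 0 y] by simp

lemma cinner_scaleC_right: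
  "cinner x (a *\<^sub>C y) = cnj a * cinner x (y :: 'a :: chilbert_space)"
  by (metis cinner_commute cinner_scaleC_left complex_cnj_mult)

lemma norm_scaleC: "norm (a *\<^sub>C (x :: 'a :: chilbert_space)) = cmod a * norm x"
proof -
  have "complex_of_real ((norm (a *\<^sub>C x))\<^sup>2) = complex_of_real ((cmod a * norm x)\<^sup>2)"
    unfolding cinner_self[symmetric] cinner_scaleC_left cinner_scaleC_right
    by (simp add: cinner_self power_mult_distrib complex_norm_square[symmetric] mult_ac
        flip: of_real_power)
  then have "(norm (a *\<^sub>C x))\<^sup>2 = (cmod a * norm x)\<^sup>2"
    by (simp only: of_real_eq_iff)
  then show ?thesis
    by (simp add: power2_eq_iff_nonneg)
qed

lemma cinner_eq_inner: "cinner x y = Complex (inner x y) (inner x (\<i> *\<^sub>C y))"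
  by (simp add: complex_eq_iff inner_eq_Re_cinner cinner_scaleC_right)

lemma cmod_cinner_le: "cmod (cinner x y) \<le> 2 * (norm x * norm (y :: 'a :: chilbert_space))"
proof -
  have "cmod (cinner x y) \<le> \<bar>inner x y\<bar> + \<bar>inner x (\<i> *\<^sub>C y)\<bar>"
    using cmod_le[of "cinner x y"] by (simp add: cinner_eq_inner)
  also have "\<dots> \<le> norm x * norm y + norm x * norm (\<i> *\<^sub>C y)"
    by (intro add_mono Cauchy_Schwarz_ineq2)
  finally show ?thesis by (simp add: norm_scaleC)
qed

instantiation complex :: chilbert_space
begin

definition scaleC_complex :: "complex \<Rightarrow> complex \<Rightarrow> complex" where
  "scaleC_complex a x = a * x"

definition cinner_complex :: "complex \<Rightarrow> complex \<Rightarrow> complex" where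
  "cinner_complex x y = x * cnj y"

instance
  by standard
     (auto simp: scaleC_complex_def cinner_complex_def inner_complex_def algebra_simps
        scaleR_conv_of_real)

end


section \<open>The Hilbert space tensor product of \<open>\<ell>\<^sup>2(J)\<close> with a Hilbert space\<close>

text \<open>
  The tensor product is realised as the space of square-summable families in the second factor,
  with \<open>a \<otimes> h = (a\<^sub>j h)\<^sub>j\<close>. The lemmas \<open>cinner_tensor\<close> and \<open>closure_span_tensor\<close> below are the
  defining properties of the Hilbert space tensor product.
\<close>

typedef (overloaded) ('j, 'h :: chilbert_space) l2 =
  "{f :: 'j \<Rightarrow> 'h. (\<lambda>j. (norm (f j))\<^sup>2) summable_on UNIV}"
  by (rule exI[of _ "\<lambda>_. 0"]) simp

setup_lifting type_definition_l2

lemma l2_summable: "(\<lambda>j. (norm (Rep_l2 f j))\<^sup>2) summable_on UNIV"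
  using Rep_l2[of f] by simp

lemma l2_add_mem:
  fixes f g :: "'j \<Rightarrow> 'h :: real_normed_vector"
  assumes "(\<lambda>j. (norm (f j))\<^sup>2) summable_on UNIV" "(\<lambda>j. (norm (g j))\<^sup>2) summable_on UNIV"
  shows "(\<lambda>j. (norm (f j + g j))\<^sup>2) summable_on UNIV"
proof (rule summable_on_comparison_test)
  show "(\<lambda>j. 2 * (norm (f j))\<^sup>2 + 2 * (norm (g j))\<^sup>2) summable_on UNIV"
    by (intro summable_on_add summable_on_cmult_right assms)
  show "(norm (f j + g j))\<^sup>2 \<le> 2 * (norm (f j))\<^sup>2 + 2 * (norm (g j))\<^sup>2" for j
  proof -
    have "(norm (f j + g j))\<^sup>2 \<le> (norm (f j) + norm (g j))\<^sup>2"
      by (intro power_mono norm_triangle_ineq) simp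
    also have "\<dots> \<le> 2 * (norm (f j))\<^sup>2 + 2 * (norm (g j))\<^sup>2"
      using zero_le_power2[of "norm (f j) - norm (g j)"]
      unfolding power2_diff power2_sum by linarith
    finally show ?thesis .
  qed
qed auto

lemma l2_scale_mem:
  fixes f :: "'j \<Rightarrow> 'h :: chilbert_space"
  assumes "(\<lambda>j. (norm (f j))\<^sup>2) summable_on UNIV"
  shows "(\<lambda>j. (norm (a *\<^sub>C f j))\<^sup>2) summable_on UNIV"
  unfolding norm_scaleC power_mult_distrib by (intro summable_on_cmult_right assms)

lemma l2_cinner_summable:
  "(\<lambda>j. cinner (Rep_l2 f j) (Rep_l2 g j)) summable_on UNIV"
proof (rule abs_summable_summable, rule summable_on_comparison_test)
  show "(\<lambda>j. (norm (Rep_l2 f j))\<^sup>2 + (norm (Rep_l2 g j))\<^sup>2) summable_on UNIV"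
    by (intro summable_on_add l2_summable)
  show "cmod (cinner (Rep_l2 f j) (Rep_l2 g j)) \<le> (norm (Rep_l2 f j))\<^sup>2 + (norm (Rep_l2 g j))\<^sup>2"
    for j
    using cmod_cinner_le[of "Rep_l2 f j" "Rep_l2 g j"]
      sum_squares_bound[of "norm (Rep_l2 f j)" "norm (Rep_l2 g j)"] by linarith
qed auto

instantiation l2 :: (type, chilbert_space) real_vector
begin

lift_definition zero_l2 :: "('a, 'b) l2" is "\<lambda>_. 0" by simp

lift_definition plus_l2 :: "('a, 'b) l2 \<Rightarrow> ('a, 'b) l2 \<Rightarrow> ('a, 'b) l2" is "\<lambda>f g j. f j + g j"
  by (rule l2_add_mem)

lift_definition uminus_l2 :: "('a, 'b) l2 \<Rightarrow> ('a, 'b) l2" is "\<lambda>f j. - f j" by simp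

lift_definition minus_l2 :: "('a, 'b) l2 \<Rightarrow> ('a, 'b) l2 \<Rightarrow> ('a, 'b) l2" is "\<lambda>f g j. f j - g j"
  using l2_add_mem[where g = "\<lambda>j. - _ j"] by simp

lift_definition scaleR_l2 :: "real \<Rightarrow> ('a, 'b) l2 \<Rightarrow> ('a, 'b) l2" is "\<lambda>r f j. r *\<^sub>R f j"
  unfolding scaleR_scaleC by (rule l2_scale_mem)

instance
  by standard (transfer; simp add: algebra_simps)+

end

lemma l2_inner_summable: "(\<lambda>j. inner (Rep_l2 f j) (Rep_l2 g j)) summable_on UNIV"
  unfolding inner_eq_Re_cinner by (intro summable_on_Re l2_cinner_summable)

instantiation l2 :: (type, chilbert_space) real_inner
begin

definition inner_l2 :: "('a, 'b) l2 \<Rightarrow> ('a, 'b) l2 \<Rightarrow> real" where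
  "inner_l2 f g = (\<Sum>\<^sub>\<infinity>j. inner (Rep_l2 f j) (Rep_l2 g j))"

definition norm_l2 :: "('a, 'b) l2 \<Rightarrow> real" where "norm_l2 f = sqrt (inner f f)"

definition sgn_l2 :: "('a, 'b) l2 \<Rightarrow> ('a, 'b) l2" where "sgn_l2 f = f /\<^sub>R norm f"

definition dist_l2 :: "('a, 'b) l2 \<Rightarrow> ('a, 'b) l2 \<Rightarrow> real" where "dist_l2 f g = norm (f - g)"

definition uniformity_l2 :: "(('a, 'b) l2 \<times> ('a, 'b) l2) filter" where
  "uniformity_l2 = (INF e\<in>{0<..}. principal {(x, y). dist x y < e})"

definition open_l2 :: "('a, 'b) l2 set \<Rightarrow> bool" where
  "open_l2 U \<longleftrightarrow> (\<forall>x\<in>U. eventually (\<lambda>(x', y). x' = x \<longrightarrow> y \<in> U) uniformity)"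

instance
proof
  fix x y z :: "('a, 'b) l2" and r :: real
  show "inner x y = inner y x"
    by (simp add: inner_l2_def inner_commute)
  show "inner (x + y) z = inner x z + inner y z"
    by (simp add: inner_l2_def plus_l2.rep_eq inner_add_left infsum_add l2_inner_summable)
  show "inner (r *\<^sub>R x) y = r * inner x y"
    by (simp add: inner_l2_def scaleR_l2.rep_eq infsum_cmult_right')
  show "0 \<le> inner x x"
    by (simp add: inner_l2_def infsum_nonneg)
  show "inner x x = 0 \<longleftrightarrow> x = 0"
  proof
    assume *: "inner x x = 0"
    have "inner (Rep_l2 x j) (Rep_l2 x j) = 0" for j
      by (rule nonneg_infsum_le_0D[where A = UNIV])
         (use * l2_inner_summable[of x x] in \<open>auto simp: inner_l2_def\<close>)
    then show "x = 0"
      by (simp add: Rep_l2_inject[symmetric] zero_l2.rep_eq fun_eq_iff)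
  qed (simp add: inner_l2_def zero_l2.rep_eq)
qed (rule norm_l2_def sgn_l2_def dist_l2_def uniformity_l2_def open_l2_def)+

end

lemma norm_l2_power2: "(norm f)\<^sup>2 = (\<Sum>\<^sub>\<infinity>j. (norm (Rep_l2 f j))\<^sup>2)"
  by (simp add: power2_norm_eq_inner inner_l2_def)

lemma sum_norm_l2_le: "finite F \<Longrightarrow> (\<Sum>j\<in>F. (norm (Rep_l2 f j))\<^sup>2) \<le> (norm f)\<^sup>2"
  unfolding norm_l2_power2 by (rule finite_sum_le_infsum[OF l2_summable]) auto

lemma norm_Rep_l2_le: "norm (Rep_l2 f j) \<le> norm f"
  using sum_norm_l2_le[of "{j}" f] by (simp add: power2_le_iff_abs_le)

lemma l2_limit:
  fixes X :: "nat \<Rightarrow> ('j, 'h :: chilbert_space) l2" and x :: "'j \<Rightarrow> 'h"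
  assumes lim: "\<And>j. (\<lambda>n. Rep_l2 (X n) j) \<longlonglongrightarrow> x j"
    and bound: "\<And>n. n \<ge> m \<Longrightarrow> norm (X m - X n) \<le> e"
  shows "(\<lambda>j. (norm (Rep_l2 (X m) j - x j))\<^sup>2) summable_on UNIV" (is ?A)
    and "(\<Sum>\<^sub>\<infinity>j. (norm (Rep_l2 (X m) j - x j))\<^sup>2) \<le> e\<^sup>2" (is ?B)
proof -
  have fin: "(\<Sum>j\<in>F. (norm (Rep_l2 (X m) j - x j))\<^sup>2) \<le> e\<^sup>2" if "finite F" for F
  proof (rule LIMSEQ_le_const2)
    show "(\<lambda>n. \<Sum>j\<in>F. (norm (Rep_l2 (X m) j - Rep_l2 (X n) j))\<^sup>2)
        \<longlonglongrightarrow> (\<Sum>j\<in>F. (norm (Rep_l2 (X m) j - x j))\<^sup>2)"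
      by (intro tendsto_intros lim)
    have "(\<Sum>j\<in>F. (norm (Rep_l2 (X m) j - Rep_l2 (X n) j))\<^sup>2) \<le> e\<^sup>2" if "n \<ge> m" for n
    proof -
      have "(\<Sum>j\<in>F. (norm (Rep_l2 (X m) j - Rep_l2 (X n) j))\<^sup>2) \<le> (norm (X m - X n))\<^sup>2"
        using sum_norm_l2_le[OF \<open>finite F\<close>, of "X m - X n"] by (simp add: minus_l2.rep_eq)
      also have "\<dots> \<le> e\<^sup>2" by (intro power_mono bound that) simp
      finally show ?thesis .
    qed
    then show "\<exists>N. \<forall>n\<ge>N. (\<Sum>j\<in>F. (norm (Rep_l2 (X m) j - Rep_l2 (X n) j))\<^sup>2) \<le> e\<^sup>2" by blast
  qed
  show A: ?A
    by (rule nonneg_bdd_above_summable_on) (auto intro!: bdd_aboveI2 fin)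
  show ?B
    by (rule infsum_le_finite_sums[OF A]) (rule fin)
qed

instance l2 :: (type, chilbert_space) complete_space
proof
  fix X :: "nat \<Rightarrow> ('a, 'b) l2"
  assume X: "Cauchy X"
  have Cauchy: "Cauchy (\<lambda>n. Rep_l2 (X n) j)" for j
  proof (rule metric_CauchyI)
    fix e :: real assume "e > 0"
    then obtain M where M: "\<And>m n. m \<ge> M \<Longrightarrow> n \<ge> M \<Longrightarrow> dist (X m) (X n) < e"
      using metric_CauchyD[OF X] by blast
    have "dist (Rep_l2 (X m) j) (Rep_l2 (X n) j) \<le> dist (X m) (X n)" for m n
      using norm_Rep_l2_le[of "X m - X n" j] by (simp add: dist_norm minus_l2.rep_eq)
    then show "\<exists>M. \<forall>m\<ge>M. \<forall>n\<ge>M. dist (Rep_l2 (X m) j) (Rep_l2 (X n) j) < e"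
      using M by (intro exI[of _ M] allI impI) (rule le_less_trans)
  qed
  have "\<exists>y. (\<lambda>n. Rep_l2 (X n) j) \<longlonglongrightarrow> y" for j
    using Cauchy_convergent[OF Cauchy[of j]] unfolding convergent_def .
  then have "\<exists>x. \<forall>j. (\<lambda>n. Rep_l2 (X n) j) \<longlonglongrightarrow> x j"
    by (intro choice allI)
  then obtain x where x: "\<And>j. (\<lambda>n. Rep_l2 (X n) j) \<longlonglongrightarrow> x j" by blast
  have ev: "\<exists>M. \<forall>m\<ge>M. \<forall>n\<ge>m. norm (X m - X n) \<le> e" if "e > 0" for e :: real
  proof -
    obtain M where "\<And>m n. m \<ge> M \<Longrightarrow> n \<ge> M \<Longrightarrow> dist (X m) (X n) < e"
      using metric_CauchyD[OF X \<open>e > 0\<close>] by blast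
    then have "\<forall>m\<ge>M. \<forall>n\<ge>m. norm (X m - X n) \<le> e"
      unfolding dist_norm using less_imp_le order_trans by blast
    then show ?thesis by blast
  qed
  have "(\<lambda>j. (norm (x j))\<^sup>2) summable_on UNIV"
  proof -
    obtain m where m: "\<And>n. n \<ge> m \<Longrightarrow> norm (X m - X n) \<le> 1"
      using ev[of 1] by auto
    have "(\<lambda>j. (norm (- (Rep_l2 (X m) j - x j)))\<^sup>2) summable_on UNIV"
      unfolding norm_minus_cancel by (rule l2_limit(1)[OF x m])
    from l2_add_mem[OF l2_summable[of "X m"] this] show ?thesis by simp
  qed
  then have rep: "Rep_l2 (Abs_l2 x) = x" by (simp add: Abs_l2_inverse)
  have "X \<longlonglongrightarrow> Abs_l2 x"
  proof (rule metric_LIMSEQ_I)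
    fix r :: real assume r: "r > 0"
    then obtain M where M: "\<forall>m\<ge>M. \<forall>n\<ge>m. norm (X m - X n) \<le> r / 2"
      using ev[of "r / 2"] by auto
    have "dist (X m) (Abs_l2 x) < r" if "m \<ge> M" for m
    proof -
      have "(norm (X m - Abs_l2 x))\<^sup>2 \<le> (r / 2)\<^sup>2"
        unfolding norm_l2_power2 minus_l2.rep_eq rep
        by (rule l2_limit(2)[OF x]) (use M that in auto)
      then have "norm (X m - Abs_l2 x) \<le> r / 2"
        by (rule power2_le_imp_le) (use r in simp)
      then show ?thesis using r by (simp add: dist_norm)
    qed
    then show "\<exists>no. \<forall>n\<ge>no. dist (X n) (Abs_l2 x) < r" by blast
  qed
  then show "convergent X" by (auto simp: convergent_def)
qed

instantiation l2 :: (type, chilbert_space) chilbert_space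
begin

lift_definition scaleC_l2 :: "complex \<Rightarrow> ('a, 'b) l2 \<Rightarrow> ('a, 'b) l2" is "\<lambda>a f j. a *\<^sub>C f j"
  by (rule l2_scale_mem)

definition cinner_l2 :: "('a, 'b) l2 \<Rightarrow> ('a, 'b) l2 \<Rightarrow> complex" where
  "cinner_l2 f g = (\<Sum>\<^sub>\<infinity>j. cinner (Rep_l2 f j) (Rep_l2 g j))"

instance
proof
  fix x y z :: "('a, 'b) l2" and r :: real and a b :: complex
  show "a *\<^sub>C (x + y) = a *\<^sub>C x + a *\<^sub>C y" "(a + b) *\<^sub>C x = a *\<^sub>C x + b *\<^sub>C x"
    "a *\<^sub>C b *\<^sub>C x = (a * b) *\<^sub>C x" "r *\<^sub>R x = complex_of_real r *\<^sub>C x"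
    by (transfer; simp add: scaleC_add_right scaleC_add_left scaleC_scaleC scaleR_scaleC)+
  show "cinner x y = cnj (cinner y x)"
    unfolding cinner_l2_def infsum_cnj[symmetric] by (intro infsum_cong cinner_commute)
  show "cinner (x + y) z = cinner x z + cinner y z"
    by (simp add: cinner_l2_def plus_l2.rep_eq cinner_add_left infsum_add l2_cinner_summable)
  show "cinner (a *\<^sub>C x) y = a * cinner x y"
    by (simp add: cinner_l2_def scaleC_l2.rep_eq cinner_scaleC_left infsum_cmult_right')
  show "inner x y = Re (cinner x y)"
    by (simp add: inner_l2_def cinner_l2_def inner_eq_Re_cinner infsum_Re[OF l2_cinner_summable])
qed

end

type_synonym 'j ell2 = "('j, complex) l2"

lift_definition basis_vec :: "'j \<Rightarrow> 'j ell2" is "\<lambda>j i. if i = j then 1 else 0"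
proof -
  fix j :: 'j
  show "(\<lambda>i. (norm (if i = j then 1 else 0 :: complex))\<^sup>2) summable_on UNIV"
    by (rule finite_nonzero_values_imp_summable_on) (rule finite_subset[of _ "{j}"], auto)
qed

lift_definition tensor :: "'j ell2 \<Rightarrow> 'h :: chilbert_space \<Rightarrow> ('j, 'h) l2" (infixr \<open>\<otimes>\<close> 70)
  is "\<lambda>a h j. a j *\<^sub>C h"
  unfolding norm_scaleC power_mult_distrib by (intro summable_on_cmult_left)

lemma cinner_tensor: "cinner (a \<otimes> h) (b \<otimes> k) = cinner a b * cinner h k"
proof -
  have "cinner (Rep_l2 (a \<otimes> h) j) (Rep_l2 (b \<otimes> k) j)
      = cinner (Rep_l2 a j) (Rep_l2 b j) * cinner h k" for j
    by (simp add: tensor.rep_eq cinner_scaleC_left cinner_scaleC_right cinner_complex_def)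
  then show ?thesis
    by (simp add: cinner_l2_def infsum_cmult_left')
qed

lemma closure_span_tensor: "closure (span {a \<otimes> h |a h. True}) = (UNIV :: ('j, 'h :: chilbert_space) l2 set)"
proof -
  have "f \<in> closure (span {a \<otimes> h |a h. True})" for f :: "('j, 'h) l2"
  proof (rule closure_approachable[THEN iffD2], intro allI impI)
    fix e :: real assume e: "e > 0"
    define g where "g F = (\<Sum>j\<in>F. basis_vec j \<otimes> Rep_l2 f j)" for F
    have Rep_sum: "Rep_l2 (\<Sum>j\<in>F. s j) i = (\<Sum>j\<in>F. Rep_l2 (s j) i)"
      for F :: "'j set" and s :: "'j \<Rightarrow> ('j, 'h) l2" and i
      by (induction F rule: infinite_finite_induct) (auto simp: zero_l2.rep_eq plus_l2.rep_eq)
    have one: "(1 :: complex) *\<^sub>C h = h" for h :: 'h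
      using scaleR_scaleC[of 1 h] by simp
    have Rep_g: "Rep_l2 (g F) i = (if i \<in> F then Rep_l2 f i else 0)" if "finite F" for F i
    proof -
      have "Rep_l2 (g F) i = (\<Sum>j\<in>F. if i = j then Rep_l2 f j else 0)"
        unfolding g_def Rep_sum
        by (intro sum.cong refl) (simp add: tensor.rep_eq basis_vec.rep_eq one)
      then show ?thesis using that by simp
    qed
    have "\<exists>F. finite F \<and> F \<subseteq> UNIV \<and>
        dist (\<Sum>j\<in>F. (norm (Rep_l2 f j))\<^sup>2) (\<Sum>\<^sub>\<infinity>j. (norm (Rep_l2 f j))\<^sup>2) \<le> e\<^sup>2 / 2"
      using infsum_finite_approximation[OF l2_summable[of f], of "e\<^sup>2 / 2"] e by simp
    then obtain F where F: "finite F"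
      and d: "dist (\<Sum>j\<in>F. (norm (Rep_l2 f j))\<^sup>2) ((norm f)\<^sup>2) \<le> e\<^sup>2 / 2"
      by (auto simp: norm_l2_power2)
    have "(norm f)\<^sup>2 = (norm (g F))\<^sup>2 + (norm (f - g F))\<^sup>2"
      unfolding norm_l2_power2
      by (subst infsum_add[OF l2_summable l2_summable, symmetric])
         (intro infsum_cong, simp add: minus_l2.rep_eq Rep_g[OF F])
    moreover have "(norm (g F))\<^sup>2 = (\<Sum>j\<in>F. (norm (Rep_l2 f j))\<^sup>2)"
    proof -
      have "(norm (g F))\<^sup>2 = (\<Sum>\<^sub>\<infinity>j\<in>F. (norm (Rep_l2 f j))\<^sup>2)"
        unfolding norm_l2_power2 by (intro infsum_cong_neutral) (auto simp: Rep_g[OF F])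
      then show ?thesis using F by simp
    qed
    ultimately have "(norm (f - g F))\<^sup>2 \<le> e\<^sup>2 / 2"
      using d by (simp add: dist_real_def)
    also have "\<dots> < e\<^sup>2" using e by simp
    finally have "norm (f - g F) < e"
      by (rule power2_less_imp_less) (use e in simp)
    moreover have "g F \<in> span {a \<otimes> h |a h. True}"
      unfolding g_def by (intro span_sum span_base) blast
    ultimately show "\<exists>y\<in>span {a \<otimes> h |a h. True}. dist y f < e"
      by (metis dist_norm norm_minus_commute)
  qed
  then show ?thesis by blast
qed


section \<open>Bounded operators\<close>

text \<open>
  Bounded complex-linear operators between subspaces \<open>X\<close> and \<open>Y\<close>. Functions are total, so for
  \<open>X \<noteq> UNIV\<close> the values outside \<open>X\<close> are irrelevant.
\<close>

definition bop_on :: "'a :: chilbert_space set \<Rightarrow> 'b :: chilbert_space set \<Rightarrow> ('a \<Rightarrow> 'b) set" where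
  "bop_on X Y = {T. T ` X \<subseteq> Y \<and> (\<forall>x\<in>X. \<forall>y\<in>X. T (x + y) = T x + T y) \<and>
     (\<forall>c. \<forall>x\<in>X. T (c *\<^sub>C x) = c *\<^sub>C T x) \<and> (\<exists>K. \<forall>x\<in>X. norm (T x) \<le> K * norm x)}"

abbreviation bop :: "('a :: chilbert_space \<Rightarrow> 'b :: chilbert_space) set" where
  "bop \<equiv> bop_on UNIV UNIV"

definition adj :: "('a :: chilbert_space \<Rightarrow> 'b :: chilbert_space) \<Rightarrow> 'b \<Rightarrow> 'a" where
  "adj T = (THE S. S \<in> bop \<and> (\<forall>x y. cinner (T x) y = cinner x (S y)))"

definition positive_op :: "('a :: chilbert_space \<Rightarrow> 'a) \<Rightarrow> bool" where
  "positive_op T \<longleftrightarrow> T \<in> bop \<and> (\<forall>x. cinner (T x) x \<in> \<real>\<^sub>\<ge>\<^sub>0)"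

definition invertible_on :: "'a :: chilbert_space set \<Rightarrow> ('a \<Rightarrow> 'a) \<Rightarrow> bool" where
  "invertible_on X T \<longleftrightarrow>
     T \<in> bop_on X X \<and> (\<exists>N\<in>bop_on X X. \<forall>x\<in>X. N (T x) = x \<and> T (N x) = x)"

definition ortho_compl :: "'a :: chilbert_space set \<Rightarrow> 'a set" where
  "ortho_compl X = {y. \<forall>x\<in>X. cinner x y = 0}"

text \<open>
  Operators in \<open>B(X)\<close>, extended by \<open>0\<close> on the orthogonal complement of the closed subspace \<open>X\<close>.
\<close>

definition bop_ext :: "'a :: chilbert_space set \<Rightarrow> ('a \<Rightarrow> 'a) set" where
  "bop_ext X = {T \<in> bop. T ` X \<subseteq> X \<and> (\<forall>y\<in>ortho_compl X. T y = 0)}"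

definition inv_on :: "'a :: chilbert_space set \<Rightarrow> ('a \<Rightarrow> 'a) \<Rightarrow> 'a \<Rightarrow> 'a" where
  "inv_on X T = (THE N. N \<in> bop_ext X \<and> (\<forall>x\<in>X. N (T x) = x \<and> T (N x) = x))"

definition sqrt_on :: "'a :: chilbert_space set \<Rightarrow> ('a \<Rightarrow> 'a) \<Rightarrow> 'a \<Rightarrow> 'a" where
  "sqrt_on X T = (THE R. R \<in> bop_ext X \<and> positive_op R \<and> (\<forall>x\<in>X. R (R x) = T x))"

definition partial_isometry :: "('a :: chilbert_space \<Rightarrow> 'b :: chilbert_space) \<Rightarrow> bool" where
  "partial_isometry V \<longleftrightarrow>
     V \<in> bop \<and> (\<forall>x\<in>ortho_compl {z. V z = 0}. norm (V x) = norm x)"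


section \<open>Operator-valued frames\<close>

text \<open>
  The index set is the type \<open>'j\<close>, the Hilbert spaces are \<open>'h\<close> and \<open>'k\<close>. Pointwise \<open>has_sum\<close> over
  \<open>UNIV\<close> is strong convergence of the net of finite partial sums.
\<close>

type_synonym ('j, 'h, 'k) op_family = "'j \<Rightarrow> 'h \<Rightarrow> 'k"

definition frames :: "('j, 'h :: chilbert_space, 'k :: chilbert_space) op_family set" where
  "frames = {A. (\<forall>j. A j \<in> bop) \<and>
     (\<exists>S. positive_op S \<and> invertible_on UNIV S \<and>
        (\<forall>x. ((\<lambda>j. adj (A j) (A j x)) has_sum S x) UNIV))}"

definition frame_op :: "('j, 'h :: chilbert_space, 'k :: chilbert_space) op_family \<Rightarrow> 'h \<Rightarrow> 'h" where
  "frame_op A x = (\<Sum>\<^sub>\<infinity>j. adj (A j) (A j x))"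

definition coord_emb :: "'j \<Rightarrow> 'k :: chilbert_space \<Rightarrow> ('j, 'k) l2" where
  "coord_emb j h = basis_vec j \<otimes> h"

definition analysis ::
  "('j, 'h :: chilbert_space, 'k :: chilbert_space) op_family \<Rightarrow> 'h \<Rightarrow> ('j, 'k) l2" where
  "analysis A x = (\<Sum>\<^sub>\<infinity>j. coord_emb j (A j x))"

definition frame_map ::
  "('j, 'h :: chilbert_space, 'k :: chilbert_space) op_family \<Rightarrow> ('j, 'h, 'k) op_family
     \<Rightarrow> ('j, 'k) l2 \<Rightarrow> ('j, 'k) l2" where
  "frame_map A B = analysis B \<circ> inv_on UNIV (frame_op A) \<circ> adj (analysis A)"

definition frame_proj ::
  "('j, 'h :: chilbert_space, 'k :: chilbert_space) op_family \<Rightarrow> ('j, 'k) l2 \<Rightarrow> ('j, 'k) l2" where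
  "frame_proj A = analysis A \<circ> inv_on UNIV (frame_op A) \<circ> adj (analysis A)"

definition frame_params ::
  "('j, 'h :: chilbert_space, 'k :: chilbert_space) op_family
     \<Rightarrow> (('j, 'k) l2 \<Rightarrow> ('j, 'k) l2) set" where
  "frame_params A = {M \<in> bop. M = M \<circ> frame_proj A \<and>
     invertible_on (range (frame_proj A)) (adj M \<circ> M)}"

text \<open>The operator \<open>V\<^sub>M = M (M^*M)^{-1/2}\<close>, with inverse and positive square root taken in \<open>B(P\<^sub>A(\<ell>\<^sup>2(J) \<otimes> H\<^sub>o))\<close>.\<close>

definition polar_part ::
  "('j, 'h :: chilbert_space, 'k :: chilbert_space) op_family
     \<Rightarrow> (('j, 'k) l2 \<Rightarrow> ('j, 'k) l2) \<Rightarrow> ('j, 'k) l2 \<Rightarrow> ('j, 'k) l2" where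
  "polar_part A M = (let X = range (frame_proj A)
     in M \<circ> sqrt_on X (inv_on X (adj M \<circ> M)))"

end

theory Submission
  imports Defs
begin

text \<open>
  Write \<open>T\<^sub>A\<close> for the analysis operator of \<open>A\<close>, \<open>S\<^sub>A = T\<^sub>A\<^sup>* T\<^sub>A\<close> for its frame operator and \<open>P\<close> for
  the frame projection \<open>T\<^sub>A S\<^sub>A\<^sup>-\<^sup>1 T\<^sub>A\<^sup>*\<close>. The map \<open>B \<mapsto> T\<^sub>B\<close> is a bijection between the frames and
  the bounded operators \<open>T\<close> with \<open>T\<^sup>* T\<close> invertible, with inverse \<open>T \<mapsto> (L\<^sub>j\<^sup>* T)\<^sub>j\<close>
  (\<open>frame_analysis\<close>, \<open>coordinates_frame\<close>, \<open>analysis_coordinates\<close>). This rests on the expansion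
  \<open>f = \<Sum>\<^sub>j L\<^sub>j f\<^sub>j\<close> (\<open>has_sum_coord_emb\<close>).

  In terms of analysis operators the parametrisation is \<open>T\<^sub>B \<mapsto> M = T\<^sub>B S\<^sub>A\<^sup>-\<^sup>1 T\<^sub>A\<^sup>*\<close> with inverse
  \<open>M \<mapsto> M T\<^sub>A\<close>, because \<open>S\<^sub>A\<^sup>-\<^sup>1 T\<^sub>A\<^sup>* T\<^sub>A = 1\<close> and \<open>M T\<^sub>A S\<^sub>A\<^sup>-\<^sup>1 T\<^sub>A\<^sup>* = M P = M\<close>. The invertibility
  conditions correspond to each other: the inverse of \<open>M\<^sup>* M\<close> on the range of \<open>P\<close> is
  \<open>T\<^sub>A S\<^sub>B\<^sup>-\<^sup>1 T\<^sub>A\<^sup>*\<close> (\<open>frame_map_props\<close>), and if \<open>N\<close> is the inverse of \<open>M\<^sup>* M\<close> on the range of \<open>P\<close>, then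
  the inverse of \<open>T\<^sub>A\<^sup>* M\<^sup>* M T\<^sub>A\<close> is \<open>S\<^sub>A\<^sup>-\<^sup>1 T\<^sub>A\<^sup>* N T\<^sub>A S\<^sub>A\<^sup>-\<^sup>1\<close> (\<open>frame_of_param\<close>).

  With \<open>V = M N\<^sup>1\<^sup>/\<^sup>2\<close>, a computation gives \<open>V\<^sup>* V = P\<close> and \<open>V V\<^sup>* = M N M\<^sup>*\<close>
  (\<open>polar_part_of_invertible\<close>), and inserting \<open>N = T\<^sub>A S\<^sub>B\<^sup>-\<^sup>1 T\<^sub>A\<^sup>*\<close> turns the latter into the frame
  projection of \<open>B\<close>.

  Adjoints come from the Riesz representation theorem. Square roots are only needed for operators
  that are bounded below by a positive constant; for these Banach's fixed point theorem gives one
  that commutes with the whole commutant of the operator, which implies uniqueness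
  (\<open>strictly_positive_sqrt_exists\<close>, \<open>strictly_positive_sqrt_unique\<close>).
\<close>

section \<open>Riesz representation and real adjoints\<close>

instance chilbert_space \<subseteq> banach ..

text \<open>The representing vector is the minimiser of \<open>g y = \<parallel>y\<parallel>\<^sup>2 - 2 f y\<close>.\<close>

lemma riesz_representation_real:
  fixes f :: "'a :: {real_inner, banach} \<Rightarrow> real"
  assumes f: "bounded_linear f"
  obtains y where "\<And>x. f x = inner y x"
proof -
  interpret f: bounded_linear f by (rule f)
  define g where "g y = (norm y)\<^sup>2 - 2 * f y" for y
  obtain K where K: "\<And>x. \<bar>f x\<bar> \<le> norm x * K"
    using f.bounded by (auto simp: real_norm_def)
  have "- K\<^sup>2 \<le> g y" for y
  proof -
    have "0 \<le> (norm y - K)\<^sup>2" by simp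
    then show ?thesis using K[of y] unfolding g_def power2_diff by (auto simp: abs_le_iff)
  qed
  then have bdd: "bdd_below (range g)" by (intro bdd_belowI2)
  define m where "m = Inf (range g)"
  have m_le: "m \<le> g y" for y unfolding m_def by (rule cInf_lower) (use bdd in auto)
  have "\<exists>y. g y < m + 1 / Suc n" for n :: nat
    using cInf_lessD[of "range g" "m + 1 / Suc n"] by (auto simp: m_def)
  then obtain Y where Y: "\<And>n. g (Y n) < m + 1 / Suc n" by metis
  \<comment> \<open>the parallelogram law: minimising sequences of \<open>g\<close> are Cauchy\<close>
  have par: "(norm (a - b))\<^sup>2 = 2 * g a + 2 * g b - 4 * g ((1/2) *\<^sub>R (a + b))" for a b
    by (simp add: g_def f.add f.scaleR power2_norm_eq_inner inner_add inner_diff inner_commute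
        algebra_simps)
  have dist_le: "(norm (Y a - Y b))\<^sup>2 \<le> 2 / Suc a + 2 / Suc b" for a b
    using par[of "Y a" "Y b"] Y[of a] Y[of b] m_le[of "(1/2) *\<^sub>R (Y a + Y b)"] by simp
  have "Cauchy Y"
  proof (rule CauchyI)
    fix e :: real assume e: "e > 0"
    obtain N :: nat where N: "4 / e\<^sup>2 < N" using reals_Archimedean2 by blast
    have "norm (Y a - Y b) < e" if "a \<ge> N" "b \<ge> N" for a b
    proof -
      have "2 / Suc a \<le> 2 / Suc N" "2 / Suc b \<le> 2 / Suc N"
        using that by (auto intro!: divide_left_mono)
      moreover have "4 / Suc N < e\<^sup>2"
      proof -
        have "4 < N * e\<^sup>2" using N e by (simp add: field_simps)
        also have "\<dots> \<le> Suc N * e\<^sup>2" by (intro mult_right_mono) auto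
        finally show ?thesis by (simp add: field_simps)
      qed
      ultimately have "(norm (Y a - Y b))\<^sup>2 < e\<^sup>2" using dist_le[of a b] by simp
      then show ?thesis by (rule power2_less_imp_less) (use e in simp)
    qed
    then show "\<exists>M. \<forall>m\<ge>M. \<forall>n\<ge>M. norm (Y m - Y n) < e" by blast
  qed
  then obtain y where y: "Y \<longlonglongrightarrow> y" using Cauchy_convergent convergent_def by blast
  have "(\<lambda>n. g (Y n)) \<longlonglongrightarrow> g y"
    unfolding g_def by (intro tendsto_intros y f.tendsto)
  moreover have "(\<lambda>n. m + 1 / Suc n) \<longlonglongrightarrow> m + 0"
    by (intro tendsto_add tendsto_const LIMSEQ_Suc[OF lim_const_over_n])
  ultimately have gy: "g y \<le> m"
    using Y by (intro LIMSEQ_le[of "\<lambda>n. g (Y n)" _ "\<lambda>n. m + 1 / Suc n"]) (auto intro: less_imp_le)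
  have "f x = inner y x" for x
  proof (rule ccontr)
    assume ne: "f x \<noteq> inner y x"
    define d where "d = f x - inner y x"
    have x: "x \<noteq> 0" using ne by auto
    \<comment> \<open>the step along \<open>x\<close> that minimises the quadratic polynomial \<open>t \<mapsto> g (y + t x)\<close>\<close>
    define t where "t = d / (norm x)\<^sup>2"
    have "g (y + t *\<^sub>R x) = g y + t\<^sup>2 * (norm x)\<^sup>2 - 2 * t * d"
      unfolding g_def d_def power2_norm_eq_inner
      by (simp add: f.add f.scaleR inner_add inner_commute algebra_simps power2_eq_square)
    also have "\<dots> = g y - d\<^sup>2 / (norm x)\<^sup>2"
      using x by (simp add: t_def power_divide power2_eq_square field_simps)
    also have "\<dots> < g y" using x ne by (simp add: d_def)
    finally show False using m_le[of "y + t *\<^sub>R x"] gy by simp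
  qed
  then show thesis by (rule that)
qed

lemma real_adjoint_exists:
  fixes T :: "'a :: {real_inner, banach} \<Rightarrow> 'b :: real_inner"
  assumes T: "bounded_linear T"
  obtains S where "bounded_linear S" "\<And>x y. inner (T x) y = inner x (S y)"
proof -
  interpret T: bounded_linear T by (rule T)
  have "\<exists>z. \<forall>x. inner (T x) y = inner z x" for y
    using riesz_representation_real[OF bounded_linear_compose[OF bounded_linear_inner_left T], of y]
    by metis
  then obtain S where S: "\<And>x y. inner (T x) y = inner x (S y)"
    by (metis inner_commute)
  obtain K where K: "K > 0" "\<And>x. norm (T x) \<le> norm x * K"
    using T.pos_bounded by blast
  have "bounded_linear S"
  proof (rule bounded_linear_intro)
    show "S (x + y) = S x + S y" for x y
      by (rule vector_eq_ldot[THEN iffD1]) (simp add: inner_add_right flip: S)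
    show "S (r *\<^sub>R x) = r *\<^sub>R S x" for r x
      by (rule vector_eq_ldot[THEN iffD1]) (simp flip: S)
    show "norm (S y) \<le> norm y * K" for y
    proof (cases "S y = 0")
      case False
      have "norm (S y) * norm (S y) = inner (T (S y)) y"
        by (simp add: S flip: power2_norm_eq_inner power2_eq_square)
      also have "\<dots> \<le> norm (T (S y)) * norm y" by (rule norm_cauchy_schwarz)
      also have "\<dots> \<le> (norm (S y) * K) * norm y" by (intro mult_right_mono K) simp
      finally show ?thesis using False by (simp add: mult_ac)
    qed (use K in simp)
  qed
  then show thesis using S by (rule that)
qed

section \<open>Square roots of strictly positive operators\<close>

text \<open>
  For small \<open>c > 0\<close> the operator \<open>B = 1 - c T\<close> has norm \<open>q < 1\<close>, so \<open>Y \<mapsto> (B + Y\<^sup>2) / 2\<close> is a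
  contraction of the ball of radius \<open>q\<close>. A fixed point \<open>Y\<close> satisfies \<open>(1 - Y)\<^sup>2 = 1 - B = c T\<close>.
  Self-adjointness and commuting with the commutant of \<open>T\<close> are closed conditions preserved by the
  iteration, hence hold for \<open>Y\<close>.
\<close>

lemma strictly_positive_sqrt_exists:
  fixes T :: "'a :: {real_inner, banach} \<Rightarrow> 'a"
  assumes T: "bounded_linear T" and sym: "\<And>x y. inner (T x) y = inner x (T y)"
    and d: "d > 0" and pos: "\<And>x. d * (norm x)\<^sup>2 \<le> inner (T x) x"
  obtains R e where "bounded_linear R" "\<And>x y. inner (R x) y = inner x (R y)"
    "e > 0" "\<And>x. e * (norm x)\<^sup>2 \<le> inner (R x) x" "\<And>x. R (R x) = T x"
    "\<forall>Z. bounded_linear Z \<longrightarrow> (\<forall>x. Z (T x) = T (Z x)) \<longrightarrow> (\<forall>x. Z (R x) = R (Z x))"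
proof -
  interpret T: bounded_linear T by (rule T)
  obtain K0 where K0: "K0 > 0" "\<And>x. norm (T x) \<le> norm x * K0"
    using T.pos_bounded by blast
  define K where "K = max K0 d"
  have K: "K > 0" "d \<le> K" using K0 by (auto simp: K_def)
  have T_le: "norm (T x) \<le> K * norm x" for x
    using K0(2)[of x] mult_left_mono[of K0 K "norm x"] by (auto simp: K_def mult_ac)
  \<comment> \<open>this \<open>c\<close> minimises the bound \<open>1 - 2 c d + c\<^sup>2 K\<^sup>2\<close> on the squared norm of \<open>1 - c T\<close>\<close>
  define c where "c = d / K\<^sup>2"
  have c: "c > 0" using d K by (simp add: c_def)
  define q where "q = sqrt (1 - d\<^sup>2 / K\<^sup>2)"
  have dK: "0 < d\<^sup>2 / K\<^sup>2" "d\<^sup>2 / K\<^sup>2 \<le> 1" using d K by (auto simp: divide_le_eq power_mono)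
  have q: "0 \<le> q" "q < 1" and q2: "q\<^sup>2 = 1 - d\<^sup>2 / K\<^sup>2"
    using dK by (auto simp: q_def)
  define B where "B = id_blinfun - c *\<^sub>R Blinfun T"
  have B_apply: "blinfun_apply B x = x - c *\<^sub>R T x" for x
    by (simp add: B_def blinfun.diff_left blinfun.scaleR_left bounded_linear_Blinfun_apply[OF T])
  have normB: "norm B \<le> q"
  proof (rule norm_blinfun_bound[OF q(1)])
    fix x
    have "(norm (B x))\<^sup>2 = (norm x)\<^sup>2 - 2 * c * inner (T x) x + c\<^sup>2 * (norm (T x))\<^sup>2"
      by (simp only: B_apply power2_norm_eq_inner inner_diff inner_scaleR_left inner_scaleR_right
          inner_commute[of x "T x"]) (simp add: algebra_simps power2_eq_square)
    also have "\<dots> \<le> (norm x)\<^sup>2 - 2 * c * (d * (norm x)\<^sup>2) + c\<^sup>2 * (K * norm x)\<^sup>2"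
      using c by (intro add_mono diff_mono mult_left_mono pos power_mono T_le) auto
    also have "\<dots> = (q * norm x)\<^sup>2"
      using K by (simp add: power_mult_distrib q2) (simp add: c_def field_simps power2_eq_square)
    finally show "norm (B x) \<le> q * norm x"
      by (rule power2_le_imp_le) (use q in simp)
  qed
  define C where "C = {Z. bounded_linear Z \<and> (\<forall>x. Z (T x) = T (Z x))}"
  define s where "s = {Y :: 'a \<Rightarrow>\<^sub>L 'a. norm Y \<le> q \<and>
     (\<forall>x y. inner (blinfun_apply Y x) y = inner x (blinfun_apply Y y)) \<and>
     (\<forall>Z\<in>C. \<forall>x. Z (blinfun_apply Y x) = blinfun_apply Y (Z x))}"
  define F where "F Y = (1/2) *\<^sub>R (B + (Y o\<^sub>L Y))" for Y :: "'a \<Rightarrow>\<^sub>L 'a"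
  have F_apply: "blinfun_apply (F Y) x = (1/2) *\<^sub>R (B x + Y (Y x))" for Y x
    by (simp add: F_def blinfun.add_left blinfun.scaleR_left)
  have "\<exists>!Y\<in>s. F Y = Y"
  proof (rule Banach_fix)
    have "closed s"
    proof -
      have Y: "continuous_on UNIV (\<lambda>Y :: 'a \<Rightarrow>\<^sub>L 'a. blinfun_apply Y x)" for x
        by (intro continuous_intros)
      have ZY: "continuous_on UNIV (\<lambda>Y :: 'a \<Rightarrow>\<^sub>L 'a. Z (blinfun_apply Y x))" if "Z \<in> C" for Z x
        by (rule bounded_linear.continuous_on[OF _ Y]) (use that in \<open>simp add: C_def\<close>)
      have "s = {Y. norm Y \<le> q} \<inter>
          (\<Inter>x. \<Inter>y. {Y. inner (blinfun_apply Y x) y = inner x (blinfun_apply Y y)}) \<inter>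
          (\<Inter>Z\<in>C. \<Inter>x. {Y. Z (blinfun_apply Y x) = blinfun_apply Y (Z x)})"
        by (auto simp: s_def)
      also have "closed \<dots>"
        by (intro closed_Int closed_INT ballI closed_Collect_le[OF continuous_on_norm_id]
            closed_Collect_eq[OF ZY Y] closed_Collect_eq[OF continuous_on_inner[OF Y continuous_on_const]
              continuous_on_inner[OF continuous_on_const Y]] continuous_on_const)
      finally show ?thesis .
    qed
    then show "complete s" by (simp add: complete_eq_closed)
    have "0 \<in> s" using q by (simp add: s_def C_def linear_0 bounded_linear.linear)
    then show "s \<noteq> {}" by blast
    show "F ` s \<subseteq> s"
    proof clarify
      fix Y assume Y: "Y \<in> s"
      then have Ysym: "inner (Y x) y = inner x (Y y)" for x y by (simp add: s_def)
      have "norm (F Y) \<le> (1/2) * (norm B + norm Y * norm Y)"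
        unfolding F_def norm_scaleR
        by (intro mult_mono order_trans[OF norm_triangle_ineq] add_mono norm_blinfun_compose) auto
      also have "\<dots> \<le> (1/2) * (q + q * 1)"
        using Y q by (intro mult_left_mono add_mono normB mult_mono) (auto simp: s_def)
      finally have "norm (F Y) \<le> q" by simp
      moreover have "inner (F Y x) y = inner x (F Y y)" for x y
        by (simp add: F_apply B_apply inner_add inner_diff sym Ysym)
      moreover have "Z (F Y x) = F Y (Z x)" if Z: "Z \<in> C" for Z x
      proof -
        interpret Z: bounded_linear Z using Z by (simp add: C_def)
        have ZT: "Z (T x) = T (Z x)" for x using Z by (simp add: C_def)
        have ZY: "Z (Y x) = Y (Z x)" for x using Y Z unfolding s_def by blast
        show ?thesis by (simp add: F_apply B_apply Z.add Z.diff Z.scaleR ZT ZY)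
      qed
      ultimately show "F Y \<in> s" unfolding s_def by blast
    qed
    show "dist (F Y) (F Y') \<le> q * dist Y Y'" if "Y \<in> s" "Y' \<in> s" for Y Y'
    proof -
      have eq: "F Y - F Y' = (1/2) *\<^sub>R ((Y o\<^sub>L (Y - Y')) + ((Y - Y') o\<^sub>L Y'))"
        by (rule blinfun_eqI)
          (simp add: F_apply blinfun.add_left blinfun.diff_left blinfun.scaleR_left
            blinfun.diff_right algebra_simps)
      have "norm (F Y - F Y') \<le> (1/2) * (norm Y * norm (Y - Y') + norm (Y - Y') * norm Y')"
        unfolding eq norm_scaleR
        by (intro mult_mono order_trans[OF norm_triangle_ineq] add_mono norm_blinfun_compose) auto
      also have "\<dots> \<le> (1/2) * (q * norm (Y - Y') + norm (Y - Y') * q)"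
        using that q by (intro mult_left_mono add_mono mult_mono) (auto simp: s_def)
      finally show ?thesis by (simp add: dist_norm)
    qed
  qed (use q in auto)
  then obtain Y where Y: "Y \<in> s" and FY: "F Y = Y" by blast
  have YY: "Y (Y x) = 2 *\<^sub>R Y x - B x" for x
  proof -
    have "2 *\<^sub>R Y x = 2 *\<^sub>R F Y x" by (simp only: FY)
    also have "\<dots> = B x + Y (Y x)" by (simp only: F_apply) simp
    finally show ?thesis by (simp only: eq_diff_eq add.commute)
  qed
  have normY: "norm Y \<le> q" and Ysym: "\<And>x y. inner (Y x) y = inner x (Y y)"
    using Y by (simp_all add: s_def)
  define R where "R x = (1 / sqrt c) *\<^sub>R (x - Y x)" for x
  show thesis
  proof (rule that[of R "(1 / sqrt c) * (1 - q)"])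
    show "bounded_linear R"
      unfolding R_def[abs_def]
      by (intro bounded_linear_compose[OF bounded_linear_scaleR_right] bounded_linear_sub bounded_linear_ident
          blinfun.bounded_linear_right)
    show "inner (R x) y = inner x (R y)" for x y
      by (simp add: R_def inner_diff Ysym)
    show "(1 / sqrt c) * (1 - q) > 0" using q c by simp
    show "(1 / sqrt c) * (1 - q) * (norm x)\<^sup>2 \<le> inner (R x) x" for x
    proof -
      have "inner (Y x) x \<le> norm (Y x) * norm x" by (rule norm_cauchy_schwarz)
      also have "\<dots> \<le> (q * norm x) * norm x"
        by (intro mult_right_mono order_trans[OF norm_blinfun] normY) auto
      finally have "(1 - q) * (norm x)\<^sup>2 \<le> inner (x - Y x) x"
        by (simp add: inner_diff power2_norm_eq_inner[symmetric] algebra_simps power2_eq_square)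
      then show ?thesis using c by (simp add: R_def divide_right_mono)
    qed
    show "R (R x) = T x" for x
    proof -
      have "R (R x) = (1 / sqrt c * (1 / sqrt c)) *\<^sub>R ((x - Y x) - Y (x - Y x))"
        by (simp only: R_def blinfun.scaleR_right scaleR_diff_right[symmetric] scaleR_scaleR)
      also have "(x - Y x) - Y (x - Y x) = c *\<^sub>R T x"
        by (simp add: blinfun.diff_right YY B_apply scaleR_2)
      also have "(1 / sqrt c * (1 / sqrt c)) *\<^sub>R (c *\<^sub>R T x) = T x"
        using c by simp
      finally show ?thesis .
    qed
    show "\<forall>Z. bounded_linear Z \<longrightarrow> (\<forall>x. Z (T x) = T (Z x)) \<longrightarrow> (\<forall>x. Z (R x) = R (Z x))"
    proof (intro allI impI)
      fix Z x assume Z: "bounded_linear Z" "\<forall>x. Z (T x) = T (Z x)"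
      interpret Z: bounded_linear Z by (rule Z)
      have "Z \<in> C" using Z by (simp add: C_def)
      then have "Z (Y x) = Y (Z x)" using Y unfolding s_def by blast
      then show "Z (R x) = R (Z x)" by (simp add: R_def Z.diff Z.scaleR)
    qed
  qed
qed

text \<open>
  Since \<open>R\<close> and \<open>R'\<close> commute, \<open>(R + R') (R - R') = R\<^sup>2 - R'\<^sup>2 = 0\<close>, and \<open>R + R'\<close> is injective.
\<close>

lemma strictly_positive_sqrt_unique:
  fixes R R' :: "'a :: real_inner \<Rightarrow> 'a"
  assumes R: "bounded_linear R" and e: "e > 0" and pos: "\<And>x. e * (norm x)\<^sup>2 \<le> inner (R x) x"
    and R': "bounded_linear R'" and pos': "\<And>x. 0 \<le> inner (R' x) x"
    and comm: "\<And>x. R' (R x) = R (R' x)" and sq: "\<And>x. R' (R' x) = R (R x)"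
  shows "R' = R"
proof
  fix x
  interpret R: bounded_linear R by (rule R)
  interpret R': bounded_linear R' by (rule R')
  define y where "y = R x - R' x"
  have "R y + R' y = 0" by (simp add: y_def R.diff R'.diff comm sq)
  then have "inner (R y) y + inner (R' y) y = 0" by (metis inner_add_left inner_zero_left)
  then have "e * (norm y)\<^sup>2 \<le> 0" using pos[of y] pos'[of y] by simp
  then have "y = 0" using e by (simp add: mult_le_0_iff)
  then show "R' x = R x" by (simp add: y_def)
qed


section \<open>Bounded operators and adjoints\<close>

lemma scaleC_one [simp]: "1 *\<^sub>C (x :: 'a :: chilbert_space) = x"
  using scaleR_scaleC[of 1 x] by simp

lemma inner_scaleC_i_left: "inner (\<i> *\<^sub>C x) (y :: 'a :: chilbert_space) = - inner x (\<i> *\<^sub>C y)"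
  by (simp add: inner_eq_Re_cinner cinner_scaleC_left cinner_scaleC_right)

lemma bounded_linear_scaleC: "bounded_linear (\<lambda>x :: 'a :: chilbert_space. c *\<^sub>C x)"
  by (rule bounded_linear_intro[where K = "cmod c"])
    (simp_all add: scaleC_add_right scaleR_scaleC scaleC_scaleC norm_scaleC mult_ac)

lemma scaleC_eq_Re_Im: "c *\<^sub>C (x :: 'a :: chilbert_space) = Re c *\<^sub>R x + Im c *\<^sub>R (\<i> *\<^sub>C x)"
proof -
  have "c = complex_of_real (Re c) + complex_of_real (Im c) * \<i>" by (simp add: complex_eq_iff)
  then have "c *\<^sub>C x = (complex_of_real (Re c) + complex_of_real (Im c) * \<i>) *\<^sub>C x" by simp
  then show ?thesis by (simp only: scaleC_add_left scaleC_scaleC[symmetric] scaleR_scaleC)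
qed

lemma bop_iff:
  "T \<in> bop \<longleftrightarrow> bounded_linear T \<and> (\<forall>c x. T (c *\<^sub>C x) = c *\<^sub>C T x)"
proof
  assume T: "T \<in> bop"
  then obtain K where "\<forall>x. norm (T x) \<le> K * norm x" by (auto simp: bop_on_def)
  then have "bounded_linear T" using T
    by (intro bounded_linear_intro[where K = K]) (auto simp: bop_on_def scaleR_scaleC mult.commute)
  then show "bounded_linear T \<and> (\<forall>c x. T (c *\<^sub>C x) = c *\<^sub>C T x)" using T by (auto simp: bop_on_def)
next
  assume T: "bounded_linear T \<and> (\<forall>c x. T (c *\<^sub>C x) = c *\<^sub>C T x)"
  then interpret T: bounded_linear T by simp
  obtain K where "\<And>x. norm (T x) \<le> norm x * K" using T.bounded by blast
  then have "\<exists>K. \<forall>x. norm (T x) \<le> K * norm x" by (auto simp: mult.commute)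
  then show "T \<in> bop" using T by (simp add: bop_on_def T.add)
qed

lemma bop_bounded_linear: "T \<in> bop \<Longrightarrow> bounded_linear T"
  by (simp add: bop_iff)

lemma bop_scaleC: "T \<in> bop \<Longrightarrow> T (c *\<^sub>C x) = c *\<^sub>C T x"
  by (simp add: bop_iff)

lemma bop_add: "T \<in> bop \<Longrightarrow> T (x + y) = T x + T y"
  by (simp add: bop_on_def)

lemma bop_diff: "T \<in> bop \<Longrightarrow> T (x - y) = T x - T y"
  by (simp add: bop_iff bounded_linear.linear linear_diff)

lemma bop_zero: "T \<in> bop \<Longrightarrow> T 0 = 0"
  by (simp add: bop_iff bounded_linear.linear linear_0)

lemma bop_comp: "S \<in> bop \<Longrightarrow> T \<in> bop \<Longrightarrow> S \<circ> T \<in> bop"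
  by (auto simp: bop_iff o_def intro: bounded_linear_compose)

lemma bop_comp_fun: "S \<in> bop \<Longrightarrow> T \<in> bop \<Longrightarrow> (\<lambda>x. S (T x)) \<in> bop"
  using bop_comp[of S T] by (simp add: o_def)

lemma bop_ident: "(\<lambda>x. x) \<in> bop"
  by (simp add: bop_iff)

lemma bop_plus: "S \<in> bop \<Longrightarrow> T \<in> bop \<Longrightarrow> (\<lambda>x. S x + T x) \<in> bop"
  by (auto simp: bop_iff scaleC_add_right intro: bounded_linear_add)

lemma bop_minus: "S \<in> bop \<Longrightarrow> T \<in> bop \<Longrightarrow> (\<lambda>x. S x - T x) \<in> bop"
  by (auto simp: bop_iff linear_diff[OF bounded_linear.linear[OF bounded_linear_scaleC]]
      intro: bounded_linear_sub)

lemma bop_le: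
  assumes "T \<in> bop"
  obtains K where "K > 0" "\<And>x. norm (T x) \<le> K * norm x"
  using bounded_linear.pos_bounded[OF bop_bounded_linear[OF assms]] by (metis mult.commute)

lemma bop_on_UNIV_subset: "T \<in> bop \<Longrightarrow> T ` X \<subseteq> Y \<Longrightarrow> T \<in> bop_on X Y"
  by (auto simp: bop_on_def)

text \<open>
  A real adjoint of a complex-linear operator is its complex adjoint, since the imaginary part of
  the complex inner product of \<open>x\<close> and \<open>y\<close> is the real inner product of \<open>x\<close> and \<open>\<i> y\<close>.
\<close>

lemma cinner_adjoint_if_inner_adjoint:
  assumes T: "T \<in> bop" and S: "\<And>x y. inner (T x) y = inner x (S y)"
  shows "S (c *\<^sub>C y) = c *\<^sub>C S y" "cinner (T x) y = cinner x (S y)"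
proof -
  have i: "S (\<i> *\<^sub>C y) = \<i> *\<^sub>C S y" for y
  proof (rule vector_eq_ldot[THEN iffD1, rule_format])
    fix x
    have "inner x (S (\<i> *\<^sub>C y)) = - inner (T (\<i> *\<^sub>C x)) y"
      by (simp add: bop_scaleC[OF T] inner_scaleC_i_left flip: S)
    then show "inner x (S (\<i> *\<^sub>C y)) = inner x (\<i> *\<^sub>C S y)"
      by (simp add: S inner_scaleC_i_left)
  qed
  have add: "S (a + b) = S a + S b" for a b
    by (rule vector_eq_ldot[THEN iffD1]) (simp add: inner_add_right flip: S)
  have scale: "S (r *\<^sub>R a) = r *\<^sub>R S a" for r a
    by (rule vector_eq_ldot[THEN iffD1]) (simp flip: S)
  show "S (c *\<^sub>C y) = c *\<^sub>C S y"
    by (subst (1 2) scaleC_eq_Re_Im) (simp add: add scale i)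
  show "cinner (T x) y = cinner x (S y)"
    by (simp add: cinner_eq_inner S i)
qed

lemma
  assumes T: "T \<in> bop"
  shows adj_bop: "adj T \<in> bop" and inner_adj_right: "inner (T x) y = inner x (adj T y)"
proof -
  obtain S where S: "bounded_linear S" "\<And>x y. inner (T x) y = inner x (S y)"
    using real_adjoint_exists[OF bop_bounded_linear[OF T]] by blast
  note cS = cinner_adjoint_if_inner_adjoint[OF T S(2)]
  have "adj T = S" unfolding adj_def
  proof (rule the_equality)
    show "S \<in> bop \<and> (\<forall>x y. cinner (T x) y = cinner x (S y))"
      using S cS by (simp add: bop_iff)
  next
    fix S' assume "S' \<in> bop \<and> (\<forall>x y. cinner (T x) y = cinner x (S' y))"
    then have "inner x (S' y) = inner x (S y)" for x y
      using cS(2)[of x y] by (simp add: inner_eq_Re_cinner)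
    then show "S' = S" by (intro ext vector_eq_ldot[THEN iffD1]) simp
  qed
  then show "adj T \<in> bop" "inner (T x) y = inner x (adj T y)"
    using S cS by (simp_all add: bop_iff)
qed

lemma inner_adj_left: "T \<in> bop \<Longrightarrow> inner (adj T y) x = inner y (T x)"
  by (metis inner_adj_right inner_commute)

lemma adj_eqI:
  assumes "T \<in> bop" "\<And>x y. inner (T x) y = inner x (S y)"
  shows "adj T = S"
  by (intro ext vector_eq_ldot[THEN iffD1]) (simp add: assms(2) flip: inner_adj_right[OF assms(1)])

lemma adj_adj: "T \<in> bop \<Longrightarrow> adj (adj T) = T"
  by (intro adj_eqI adj_bop inner_adj_left)

lemma adj_comp: "S \<in> bop \<Longrightarrow> T \<in> bop \<Longrightarrow> adj (S \<circ> T) = adj T \<circ> adj S"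
  by (intro adj_eqI bop_comp) (simp_all add: inner_adj_right[of S] inner_adj_right[of T])

text \<open>
  Self-adjointness of a positive operator is the polarisation of \<open>Im (cinner (T z) z) = 0\<close> at
  \<open>z = x + \<i> y\<close>.
\<close>

lemma positive_op_iff:
  "positive_op T \<longleftrightarrow> T \<in> bop \<and> (\<forall>x y. inner (T x) y = inner x (T y)) \<and> (\<forall>x. 0 \<le> inner (T x) x)"
proof
  assume "positive_op T"
  then have T: "T \<in> bop" and pos: "\<And>x. cinner (T x) x \<in> \<real>\<^sub>\<ge>\<^sub>0"
    by (auto simp: positive_op_def)
  have im: "inner (T x) (\<i> *\<^sub>C x) = 0" "inner (T x) x \<ge> 0" for x
    using pos[of x] by (auto simp: cinner_eq_inner complex_nonneg_Reals_iff)
  have "inner (T x) y = inner x (T y)" for x y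
  proof -
    have ii: "\<i> *\<^sub>C \<i> *\<^sub>C z = - z" for z :: 'a
      using scaleR_scaleC[of "-1" z] by (simp add: scaleC_scaleC)
    have "inner (T (x + \<i> *\<^sub>C y)) (\<i> *\<^sub>C (x + \<i> *\<^sub>C y)) = 0" by (rule im)
    then have "inner (T x) (\<i> *\<^sub>C x) - inner (T x) y + inner (\<i> *\<^sub>C T y) (\<i> *\<^sub>C x)
        - inner (\<i> *\<^sub>C T y) y = 0"
      by (simp add: bop_add[OF T] bop_scaleC[OF T] scaleC_add_right inner_add inner_diff ii)
    moreover have "inner (\<i> *\<^sub>C T y) y = 0" "inner (\<i> *\<^sub>C T y) (\<i> *\<^sub>C x) = inner (T y) x"
      using im[of y] by (simp_all add: inner_scaleC_i_left ii)
    ultimately show ?thesis using im[of x] inner_commute[of x "T y"] by simp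
  qed
  then show "T \<in> bop \<and> (\<forall>x y. inner (T x) y = inner x (T y)) \<and> (\<forall>x. 0 \<le> inner (T x) x)"
    using T im by blast
next
  assume *: "T \<in> bop \<and> (\<forall>x y. inner (T x) y = inner x (T y)) \<and> (\<forall>x. 0 \<le> inner (T x) x)"
  then have T: "T \<in> bop" by simp
  have "inner (T x) (\<i> *\<^sub>C x) = 0" for x
  proof -
    have "inner (T x) (\<i> *\<^sub>C x) = - inner (T (\<i> *\<^sub>C x)) x"
      by (simp add: bop_scaleC[OF T] inner_scaleC_i_left)
    also have "inner (T (\<i> *\<^sub>C x)) x = inner (\<i> *\<^sub>C x) (T x)" using * by blast
    also have "\<dots> = inner (T x) (\<i> *\<^sub>C x)" by (rule inner_commute)
    finally show ?thesis by simp
  qed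
  moreover have "0 \<le> inner (T x) x" for x using * by blast
  ultimately show "positive_op T"
    using T by (simp add: positive_op_def cinner_eq_inner complex_nonneg_Reals_iff)
qed

section \<open>Inverses and square roots on the range of a projection\<close>

text \<open>Orthogonal projections are encoded as self-adjoint idempotents.\<close>

definition orth_proj :: "('a :: chilbert_space \<Rightarrow> 'a) \<Rightarrow> bool" where
  "orth_proj P \<longleftrightarrow> P \<in> bop \<and> (\<forall>x. P (P x) = P x) \<and> (\<forall>x y. inner (P x) y = inner x (P y))"

lemma orth_proj_mem_range: "orth_proj P \<Longrightarrow> x \<in> range P \<longleftrightarrow> P x = x"
  unfolding orth_proj_def by (metis rangeE rangeI)

text \<open>
  On subsets closed under multiplication by \<open>\<i>\<close>, real and complex orthogonality agree.
\<close>

lemma ortho_compl_iff_inner: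
  assumes X: "\<And>x. x \<in> X \<Longrightarrow> \<i> *\<^sub>C x \<in> X"
  shows "y \<in> ortho_compl X \<longleftrightarrow> (\<forall>x\<in>X. inner x y = 0)"
proof
  show "y \<in> ortho_compl X \<Longrightarrow> \<forall>x\<in>X. inner x y = 0"
    by (simp add: ortho_compl_def inner_eq_Re_cinner)
  assume *: "\<forall>x\<in>X. inner x y = 0"
  have "inner x (\<i> *\<^sub>C y) = 0" if "x \<in> X" for x
    using * X[OF that] inner_scaleC_i_left[of x y] by simp
  then show "y \<in> ortho_compl X" using * by (simp add: ortho_compl_def cinner_eq_inner zero_complex.ctr)
qed

lemma ortho_compl_range_orth_proj:
  assumes P: "orth_proj P"
  shows "y \<in> ortho_compl (range P) \<longleftrightarrow> P y = 0"
proof -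
  have "y \<in> ortho_compl (range P) \<longleftrightarrow> (\<forall>x\<in>range P. inner x y = 0)"
    using P by (intro ortho_compl_iff_inner) (auto simp: orth_proj_def simp flip: bop_scaleC[of P])
  also have "\<dots> \<longleftrightarrow> (\<forall>x. inner x (P y) = 0)"
    using P by (auto simp: orth_proj_def)
  also have "\<dots> \<longleftrightarrow> P y = 0" by (metis inner_eq_zero_iff inner_zero_right)
  finally show ?thesis .
qed

lemma bop_ext_range_iff:
  assumes P: "orth_proj P"
  shows "T \<in> bop_ext (range P) \<longleftrightarrow> T \<in> bop \<and> (\<forall>x. P (T x) = T x) \<and> (\<forall>x. T (P x) = T x)"
proof
  assume T: "T \<in> bop_ext (range P)"
  then have bop: "T \<in> bop" by (simp add: bop_ext_def)
  have "T (x - P x) = 0" for x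
    using T P by (auto simp: bop_ext_def ortho_compl_range_orth_proj[OF P] orth_proj_def bop_diff[of P])
  then have TP: "T (P x) = T x" for x by (simp add: bop_diff[OF bop])
  moreover have "T (P x) \<in> range P" for x using T by (auto simp: bop_ext_def)
  ultimately show "T \<in> bop \<and> (\<forall>x. P (T x) = T x) \<and> (\<forall>x. T (P x) = T x)"
    using bop orth_proj_mem_range[OF P] by simp
next
  assume T: "T \<in> bop \<and> (\<forall>x. P (T x) = T x) \<and> (\<forall>x. T (P x) = T x)"
  then have "T ` range P \<subseteq> range P" by (metis image_subsetI rangeI)
  moreover have "T y = 0" if "P y = 0" for y using T that bop_zero by metis
  ultimately show "T \<in> bop_ext (range P)"
    using T by (simp add: bop_ext_def ortho_compl_range_orth_proj[OF P])
qed

lemma inv_on_range_eqI: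
  assumes P: "orth_proj P" and N: "N \<in> bop_ext (range P)"
    and inv: "\<And>x. P x = x \<Longrightarrow> N (T x) = x" "\<And>x. P x = x \<Longrightarrow> T (N x) = x"
  shows "inv_on (range P) T = N"
  unfolding inv_on_def
proof (rule the_equality)
  show "N \<in> bop_ext (range P) \<and> (\<forall>x\<in>range P. N (T x) = x \<and> T (N x) = x)"
    using N inv orth_proj_mem_range[OF P] by auto
next
  fix N' assume N': "N' \<in> bop_ext (range P) \<and> (\<forall>x\<in>range P. N' (T x) = x \<and> T (N' x) = x)"
  note b = bop_ext_range_iff[OF P]
  show "N' = N"
  proof
    fix x
    have Nx: "P (N (P x)) = N (P x)" using N by (simp add: b)
    have "N' (P x) = N' (T (N (P x)))"
      using inv(2)[of "P x"] P by (simp add: orth_proj_def)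
    also have "\<dots> = N (P x)" using N' Nx by (metis rangeI)
    finally show "N' x = N x" using N N' by (simp add: b)
  qed
qed

lemma inv_on_UNIV:
  assumes "invertible_on UNIV T"
  shows "inv_on UNIV T \<in> bop" "T (inv_on UNIV T x) = x" "inv_on UNIV T (T x) = x"
proof -
  obtain N where N: "N \<in> bop" "\<And>x. N (T x) = x \<and> T (N x) = x"
    using assms by (auto simp: invertible_on_def)
  have P: "orth_proj (\<lambda>x :: 'a. x)" by (simp add: orth_proj_def bop_ident)
  have "N \<in> bop_ext (range (\<lambda>x :: 'a. x))"
    unfolding bop_ext_range_iff[OF P] using N by simp
  from inv_on_range_eqI[OF P this, of T] have "inv_on (range (\<lambda>x :: 'a. x)) T = N"
    using N by simp
  then show "inv_on UNIV T \<in> bop" "T (inv_on UNIV T x) = x" "inv_on UNIV T (T x) = x"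
    using N by simp_all
qed

text \<open>
  \<open>N\<close> is strictly positive only on the range of \<open>P\<close>, but \<open>N + (1 - P)\<close> is so on the whole space.
  Its square root commutes with \<open>P\<close>, and cutting it down by \<open>P\<close> gives the square root of \<open>N\<close>.
\<close>

lemma sqrt_on_range:
  fixes N :: "'a :: chilbert_space \<Rightarrow> 'a"
  assumes P: "orth_proj P" and N: "N \<in> bop_ext (range P)"
    and sym: "\<And>x y. inner (N x) y = inner x (N y)"
    and d: "d > 0" and pos: "\<And>x. d * (norm (P x))\<^sup>2 \<le> inner (N x) x"
  shows "sqrt_on (range P) N \<in> bop_ext (range P)"
    and "\<And>x y. inner (sqrt_on (range P) N x) y = inner x (sqrt_on (range P) N y)"
    and "\<And>x. sqrt_on (range P) N (sqrt_on (range P) N x) = N x"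
proof -
  note b = bop_ext_range_iff[OF P]
  have Pbop: "P \<in> bop" and PP: "\<And>x. P (P x) = P x" and Psym: "\<And>x y. inner (P x) y = inner x (P y)"
    using P by (auto simp: orth_proj_def)
  have Nbop: "N \<in> bop" and PN: "\<And>x. P (N x) = N x" and NP: "\<And>x. N (P x) = N x"
    using N by (auto simp: b)
  define T where "T x = N x + (x - P x)" for x
  have Tbop: "T \<in> bop" unfolding T_def by (intro bop_plus bop_minus bop_ident Nbop Pbop)
  have Tsym: "inner (T x) y = inner x (T y)" for x y
    by (simp add: T_def inner_add inner_diff sym Psym)
  have PT: "P (T x) = T (P x)" for x
    by (simp add: T_def bop_add[OF Pbop] bop_diff[OF Pbop] PP PN NP)
  have compl: "inner (x - P x) x = (norm (x - P x))\<^sup>2" for x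
    using Psym[of x x] Psym[of x "P x"] by (simp add: PP power2_norm_eq_inner inner_diff inner_commute)
  have Tpos: "min d 1 * (norm x)\<^sup>2 \<le> inner (T x) x" for x
  proof -
    have "(norm x)\<^sup>2 = (norm (P x))\<^sup>2 + (norm (x - P x))\<^sup>2"
      using Psym[of x x] Psym[of x "P x"]
      by (simp add: PP power2_norm_eq_inner inner_diff inner_commute)
    then have "min d 1 * (norm x)\<^sup>2 \<le> d * (norm (P x))\<^sup>2 + 1 * (norm (x - P x))\<^sup>2"
      by (simp only: distrib_left) (intro add_mono mult_right_mono; simp)
    also have "\<dots> \<le> inner (N x) x + inner (x - P x) x"
      using pos[of x] by (simp add: compl)
    finally show ?thesis by (simp add: T_def inner_add)
  qed
  have d1: "min d 1 > 0" using d by simp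
  obtain R e where R: "bounded_linear R" "\<And>x y. inner (R x) y = inner x (R y)"
    "e > 0" "\<And>x. e * (norm x)\<^sup>2 \<le> inner (R x) x" "\<And>x. R (R x) = T x"
    "\<forall>Z. bounded_linear Z \<longrightarrow> (\<forall>x. Z (T x) = T (Z x)) \<longrightarrow> (\<forall>x. Z (R x) = R (Z x))"
    by (rule strictly_positive_sqrt_exists[OF bop_bounded_linear[OF Tbop] Tsym d1 Tpos]) (rule that)
  have comm: "Z (R x) = R (Z x)" if "bounded_linear Z" "\<And>x. Z (T x) = T (Z x)" for Z x
    using that by (rule R(6)[rule_format])
  have Rbop: "R \<in> bop"
    unfolding bop_iff
    using R(1) comm[OF bounded_linear_scaleC bop_scaleC[OF Tbop, symmetric], symmetric] by blast
  have PR: "P (R x) = R (P x)" for x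
    by (rule comm[OF bop_bounded_linear[OF Pbop] PT])
  define Q where "Q x = R (P x)" for x
  have Q_ext: "Q \<in> bop_ext (range P)"
    by (simp add: b Q_def[abs_def] PR PP bop_comp_fun[OF Rbop Pbop])
  have Q_sym: "inner (Q x) y = inner x (Q y)" for x y
    by (simp add: Q_def R(2) Psym PR)
  have QQ: "Q (Q x) = N x" for x
    by (simp add: Q_def PR PP R(5)) (simp add: T_def NP PP)
  have Q_pos: "0 \<le> inner (Q x) x" for x
  proof -
    have "Q x = P (R (P x))" by (simp add: Q_def PR PP)
    then have "inner (Q x) x = inner (R (P x)) (P x)" by (simp only: Psym)
    moreover have "0 \<le> e * (norm (P x))\<^sup>2" using R(3) by simp
    ultimately show ?thesis using R(4)[of "P x"] by simp
  qed
  have "sqrt_on (range P) N = Q" unfolding sqrt_on_def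
  proof (rule the_equality)
    show "Q \<in> bop_ext (range P) \<and> positive_op Q \<and> (\<forall>x\<in>range P. Q (Q x) = N x)"
      using Q_ext Q_sym Q_pos QQ by (simp add: positive_op_iff b)
  next
    fix Q' assume asm: "Q' \<in> bop_ext (range P) \<and> positive_op Q' \<and> (\<forall>x\<in>range P. Q' (Q' x) = N x)"
    then have Q': "Q' \<in> bop" "\<And>x. P (Q' x) = Q' x" "\<And>x. Q' (P x) = Q' x"
      "\<And>x. 0 \<le> inner (Q' x) x"
      unfolding b positive_op_iff by blast+
    have Q'Q': "Q' (Q' x) = N x" for x
    proof -
      have "\<forall>x\<in>range P. Q' (Q' x) = N x" using asm by simp
      then have "Q' (Q' (P x)) = N (P x)" by simp
      then show ?thesis by (simp add: Q'(3) NP)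
    qed
    \<comment> \<open>\<open>Q' + (1 - P)\<close> is a positive square root of \<open>T\<close>, hence equal to \<open>R\<close>\<close>
    define R' where "R' x = Q' x + (x - P x)" for x
    have R'bop: "R' \<in> bop" unfolding R'_def by (intro bop_plus bop_minus bop_ident Q' Pbop)
    have R'R': "R' (R' x) = T x" for x
      by (simp add: R'_def T_def bop_add[OF Q'(1)] bop_diff[OF Q'(1)] bop_add[OF Pbop]
          bop_diff[OF Pbop] Q' Q'Q' PP)
    have "R' = R"
    proof (rule strictly_positive_sqrt_unique[OF R(1,3,4) bop_bounded_linear[OF R'bop]])
      show "0 \<le> inner (R' x) x" for x using Q'(4)[of x] by (simp add: R'_def inner_add compl)
      show "R' (R x) = R (R' x)" for x
        by (rule comm[OF bop_bounded_linear[OF R'bop]]) (simp flip: R'R')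
      show "R' (R' x) = R (R x)" for x by (simp add: R'R' R(5))
    qed
    then have "Q x = R' (P x)" for x by (simp only: Q_def)
    then show "Q' = Q" by (simp add: fun_eq_iff R'_def Q'(3) PP)
  qed
  then show "sqrt_on (range P) N \<in> bop_ext (range P)"
    "\<And>x y. inner (sqrt_on (range P) N x) y = inner x (sqrt_on (range P) N y)"
    "\<And>x. sqrt_on (range P) N (sqrt_on (range P) N x) = N x"
    using Q_ext Q_sym QQ by simp_all
qed


section \<open>The polar decomposition\<close>

text \<open>
  The polar decomposition of an operator \<open>M\<close> that is bounded below on the range of \<open>P\<close> and vanishes
  on its complement: \<open>N\<close> is the inverse \<open>(M\<^sup>* M)\<^sup>-\<^sup>1\<close>, extended by \<open>0\<close>.
\<close>

lemma polar_part_of_invertible: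
  fixes M :: "'a :: chilbert_space \<Rightarrow> 'b :: chilbert_space"
  assumes P: "orth_proj P" and M: "M \<in> bop" and MP: "\<And>x. M (P x) = M x"
    and N: "N \<in> bop_ext (range P)"
    and NG: "\<And>x. N (adj M (M x)) = P x" and GN: "\<And>x. adj M (M (N x)) = P x"
  defines "V \<equiv> M \<circ> sqrt_on (range P) (inv_on (range P) (adj M \<circ> M))"
  shows "partial_isometry V" "adj V \<circ> V = P" "V \<circ> adj V = M \<circ> N \<circ> adj M"
proof -
  have Pbop: "P \<in> bop" and PP: "\<And>x. P (P x) = P x" and Psym: "\<And>x y. inner (P x) y = inner x (P y)"
    using P by (auto simp: orth_proj_def)
  note b = bop_ext_range_iff[OF P]
  have PN: "P (N x) = N x" and NP: "N (P x) = N x" for x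
    using N by (auto simp: b)
  have inv: "inv_on (range P) (adj M \<circ> M) = N"
    by (rule inv_on_range_eqI[OF P N]) (simp_all add: NG GN)
  have inner_N: "inner (N x) y = inner (M (N x)) (M (N y))" for x y
  proof -
    have "inner (N x) y = inner (N x) (P y)" by (simp add: PN flip: Psym)
    also have "\<dots> = inner (N x) (adj M (M (N y)))" by (simp add: GN)
    finally show ?thesis by (simp add: inner_adj_right[OF M])
  qed
  obtain K where K: "K > 0" "\<And>y. norm (adj M y) \<le> K * norm y"
    using bop_le[OF adj_bop[OF M]] by blast
  have pos: "(1 / K\<^sup>2) * (norm (P x))\<^sup>2 \<le> inner (N x) x" for x
  proof -
    have "norm (P x) \<le> K * norm (M (N x))"
      using K(2)[of "M (N x)"] by (simp add: GN)
    then have "(norm (P x))\<^sup>2 \<le> (K * norm (M (N x)))\<^sup>2" by (intro power_mono) auto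
    also have "\<dots> = K\<^sup>2 * inner (N x) x"
      by (simp add: power_mult_distrib power2_norm_eq_inner inner_N[of x x])
    finally show ?thesis using K(1) by (simp add: divide_le_eq mult.commute)
  qed
  have Nsym: "inner (N x) y = inner x (N y)" for x y
    using inner_N[of x y] inner_N[of y x] by (simp add: inner_commute)
  define R where "R = sqrt_on (range P) N"
  have d: "1 / K\<^sup>2 > 0" using K(1) by simp
  note sqrt = sqrt_on_range[OF P N Nsym d pos, folded R_def]
  have R: "R \<in> bop" and PR: "\<And>x. P (R x) = R x" and RP: "\<And>x. R (P x) = R x"
    using sqrt(1) by (auto simp: b)
  have V: "V = M \<circ> R" by (simp add: V_def inv R_def)
  have Vbop: "V \<in> bop" unfolding V by (rule bop_comp[OF M R])
  have adjR: "adj R = R" by (rule adj_eqI[OF R sqrt(2)])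
  have adjV: "adj V = R \<circ> adj M" by (simp add: V adj_comp[OF M R] adjR)
  have VV: "adj V (V x) = P x" for x
  proof -
    \<comment> \<open>with \<open>G = M\<^sup>* M\<close> and \<open>P = R\<^sup>2 G = G R\<^sup>2\<close>: \<open>R G R = R G R P = R (G R\<^sup>2) R G = R P R G = R\<^sup>2 G = P\<close>\<close>
    have "adj V (V x) = R (adj M (M (R (P x))))" by (simp add: adjV) (simp add: V RP)
    also have "P x = R (R (adj M (M x)))" by (simp add: sqrt(3) NG)
    also have "R (adj M (M (R (R (R (adj M (M x))))))) = R (P (R (adj M (M x))))"
      by (simp only: sqrt(3)[of "R (adj M (M x))"] GN)
    also have "\<dots> = P x" by (simp add: PR sqrt(3) NG)
    finally show ?thesis .
  qed
  then show "adj V \<circ> V = P" by (simp add: fun_eq_iff)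
  show "V \<circ> adj V = M \<circ> N \<circ> adj M" by (simp add: fun_eq_iff adjV) (simp add: V sqrt(3))
  show "partial_isometry V" unfolding partial_isometry_def
  proof (intro conjI ballI Vbop)
    fix x assume x: "x \<in> ortho_compl {z. V z = 0}"
    have "V (x - P x) = 0" by (simp add: bop_diff[OF Vbop]) (simp add: V RP)
    then have "cinner (x - P x) x = 0" using x by (simp add: ortho_compl_def)
    then have "inner (x - P x) x = 0" by (simp add: inner_eq_Re_cinner)
    moreover have "inner (x - P x) (P x) = 0"
      by (simp add: bop_diff[OF Pbop] PP flip: Psym)
    ultimately have "inner (x - P x) (x - P x) = 0" by (simp only: inner_diff_right)
    then have Px: "P x = x" by simp
    have "(norm (V x))\<^sup>2 = inner x (adj V (V x))"
      by (simp add: power2_norm_eq_inner inner_adj_right[OF Vbop, of x])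
    also have "\<dots> = (norm x)\<^sup>2" by (simp only: VV Px power2_norm_eq_inner)
    finally show "norm (V x) = norm x" by simp
  qed
qed

section \<open>Analysis operators\<close>

lemma Rep_l2_coord_emb: "Rep_l2 (coord_emb j h) i = (if i = j then h else 0)"
  by (simp add: coord_emb_def tensor.rep_eq basis_vec.rep_eq)

lemma inner_coord_emb: "inner (coord_emb j h) f = inner h (Rep_l2 f j)"
proof -
  have "inner (coord_emb j h) f = (\<Sum>\<^sub>\<infinity>i\<in>{j}. inner h (Rep_l2 f i))"
    unfolding inner_l2_def by (rule infsum_cong_neutral) (auto simp: Rep_l2_coord_emb)
  then show ?thesis by simp
qed

lemma coord_emb_bop: "coord_emb j \<in> bop"
  unfolding bop_iff
proof (intro conjI allI bounded_linear_intro[where K = 1])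
  show "coord_emb j (x + y) = coord_emb j x + coord_emb j y" for x y :: 'a
    by (simp add: fun_eq_iff Rep_l2_coord_emb plus_l2.rep_eq flip: Rep_l2_inject)
  show "coord_emb j (r *\<^sub>R x) = r *\<^sub>R coord_emb j x" for r and x :: 'a
    by (simp add: fun_eq_iff Rep_l2_coord_emb scaleR_l2.rep_eq flip: Rep_l2_inject)
  show "coord_emb j (c *\<^sub>C x) = c *\<^sub>C coord_emb j x" for c and x :: 'a
    by (simp add: fun_eq_iff Rep_l2_coord_emb scaleC_l2.rep_eq flip: Rep_l2_inject)
  show "norm (coord_emb j x) \<le> norm x * 1" for x :: 'a
    by (simp add: norm_eq_sqrt_inner inner_coord_emb Rep_l2_coord_emb)
qed

lemma adj_coord_emb: "adj (coord_emb j) f = Rep_l2 f j"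
  by (rule fun_cong[OF adj_eqI[OF coord_emb_bop]]) (rule inner_coord_emb)

text \<open>
  The squared distance of \<open>f\<close> to the partial sum over \<open>F\<close> is the tail \<open>\<parallel>f\<parallel>\<^sup>2 - \<Sum>\<^sub>j\<^sub>\<in>\<^sub>F \<parallel>f\<^sub>j\<parallel>\<^sup>2\<close>.
\<close>

lemma has_sum_coord_emb: "((\<lambda>j. coord_emb j (Rep_l2 f j)) has_sum f) UNIV"
proof -
  define s where "s F = (\<Sum>j\<in>F. coord_emb j (Rep_l2 f j))" for F
  have inner_s: "inner (s F) g = (\<Sum>j\<in>F. inner (Rep_l2 f j) (Rep_l2 g j))" for F g
    by (simp add: s_def inner_sum_left inner_coord_emb)
  have Rep_s: "Rep_l2 (s F) i = Rep_l2 f i" if "finite F" "i \<in> F" for F i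
  proof (rule vector_eq_ldot[THEN iffD1, rule_format])
    fix h
    have "inner (coord_emb i h) (s F) = (\<Sum>j\<in>F. if j = i then inner (Rep_l2 f i) h else 0)"
      unfolding inner_commute[of "coord_emb i h"] inner_s
      by (rule sum.cong) (auto simp: Rep_l2_coord_emb)
    also have "\<dots> = inner h (Rep_l2 f i)" using that by (simp add: inner_commute)
    finally show "inner h (Rep_l2 (s F) i) = inner h (Rep_l2 f i)"
      by (simp only: inner_coord_emb)
  qed
  have norm_s: "(norm (s F - f))\<^sup>2 = (norm f)\<^sup>2 - (\<Sum>j\<in>F. (norm (Rep_l2 f j))\<^sup>2)"
    if "finite F" for F
  proof -
    have "inner (s F) (s F) = inner (s F) f"
      unfolding inner_s using Rep_s[OF that] by (intro sum.cong) auto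
    then have "(norm (s F - f))\<^sup>2 = (norm f)\<^sup>2 - inner (s F) f"
      by (simp add: power2_norm_eq_inner inner_diff inner_commute)
    then show ?thesis by (simp add: inner_s power2_norm_eq_inner)
  qed
  have "((\<lambda>F. \<Sum>j\<in>F. (norm (Rep_l2 f j))\<^sup>2) \<longlongrightarrow> (norm f)\<^sup>2) (finite_subsets_at_top UNIV)"
    using has_sum_infsum[OF l2_summable[of f]] by (simp add: has_sum_def norm_l2_power2)
  then have "((\<lambda>F. (norm f)\<^sup>2 - (\<Sum>j\<in>F. (norm (Rep_l2 f j))\<^sup>2)) \<longlongrightarrow> (norm f)\<^sup>2 - (norm f)\<^sup>2)
      (finite_subsets_at_top UNIV)"
    by (intro tendsto_diff tendsto_const)
  then have "((\<lambda>F. sqrt ((norm f)\<^sup>2 - (\<Sum>j\<in>F. (norm (Rep_l2 f j))\<^sup>2))) \<longlongrightarrow> sqrt 0)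
      (finite_subsets_at_top UNIV)"
    by (intro tendsto_real_sqrt) simp
  then have "((\<lambda>F. norm (s F - f)) \<longlongrightarrow> 0) (finite_subsets_at_top UNIV)"
    unfolding real_sqrt_zero
    by (rule Lim_transform_eventually)
      (rule eventually_finite_subsets_at_top_weakI, simp flip: norm_s)
  then have "(s \<longlongrightarrow> f) (finite_subsets_at_top UNIV)"
    by (rule LIM_zero_cancel[OF tendsto_norm_zero_cancel])
  then show ?thesis by (simp add: has_sum_def s_def[abs_def])
qed

lemma analysis_coordinates: "analysis (\<lambda>j. adj (coord_emb j) \<circ> T) = T"
  by (rule ext) (simp add: analysis_def adj_coord_emb infsumI[OF has_sum_coord_emb])

lemma has_sum_coordinates:
  assumes T: "T \<in> bop"
  shows "((\<lambda>j. adj (adj (coord_emb j) \<circ> T) ((adj (coord_emb j) \<circ> T) x)) has_sum adj T (T x)) UNIV"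
proof -
  have "adj (adj (coord_emb j) \<circ> T) = adj T \<circ> coord_emb j" for j
    by (simp add: adj_comp[OF adj_bop[OF coord_emb_bop] T] adj_adj[OF coord_emb_bop])
  then show ?thesis
    using has_sum_bounded_linear[OF bop_bounded_linear[OF adj_bop[OF T]] has_sum_coord_emb[of "T x"]]
    by (simp add: adj_coord_emb o_def)
qed

lemma coordinates_frame:
  assumes T: "T \<in> bop" and inv: "invertible_on UNIV (adj T \<circ> T)"
  shows "(\<lambda>j. adj (coord_emb j) \<circ> T) \<in> frames"
  unfolding frames_def
proof (intro CollectI conjI allI exI[of _ "adj T \<circ> T"] inv)
  show "adj (coord_emb j) \<circ> T \<in> bop" for j
    by (intro bop_comp adj_bop coord_emb_bop T)
  show "positive_op (adj T \<circ> T)"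
    unfolding positive_op_iff using T
    by (simp add: bop_comp adj_bop inner_adj_left[OF T] inner_adj_right[OF T, symmetric])
  show "((\<lambda>j. adj (adj (coord_emb j) \<circ> T) ((adj (coord_emb j) \<circ> T) x)) has_sum (adj T \<circ> T) x) UNIV"
    for x using has_sum_coordinates[OF T] by simp
qed

text \<open>
  Conversely every frame arises in this way from its analysis operator: the sum over \<open>j\<close> of the
  squared norms of \<open>B j x\<close> is the inner product of \<open>S x\<close> and \<open>x\<close>, where \<open>S\<close> is the frame operator,
  so \<open>(B j x)\<^sub>j\<close> is square-summable.
\<close>

lemma frame_analysis:
  assumes B: "B \<in> frames"
  shows "analysis B \<in> bop" "B = (\<lambda>j. adj (coord_emb j) \<circ> analysis B)"
    "frame_op B = adj (analysis B) \<circ> analysis B" "invertible_on UNIV (frame_op B)"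
proof -
  obtain S where Bj: "\<And>j. B j \<in> bop" and S: "positive_op S" "invertible_on UNIV S"
    and sum: "\<And>x. ((\<lambda>j. adj (B j) (B j x)) has_sum S x) UNIV"
    using B unfolding frames_def by blast
  have norm_sum: "((\<lambda>j. (norm (B j x))\<^sup>2) has_sum inner (S x) x) UNIV" for x
    using has_sum_bounded_linear[OF bounded_linear_inner_left sum[of x], of x]
    by (simp add: inner_adj_left[OF Bj] power2_norm_eq_inner o_def)
  define T where "T x = Abs_l2 (\<lambda>j. B j x)" for x
  have Rep_T: "Rep_l2 (T x) j = B j x" for x j
    unfolding T_def using has_sum_imp_summable[OF norm_sum] by (simp add: Abs_l2_inverse)
  have BT: "B = (\<lambda>j. adj (coord_emb j) \<circ> T)"
    by (simp add: fun_eq_iff adj_coord_emb Rep_T)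
  have aT: "analysis B = T" by (subst BT) (rule analysis_coordinates)
  have Sbop: "S \<in> bop" using S by (simp add: positive_op_def)
  obtain K where K: "K > 0" "\<And>x. norm (S x) \<le> K * norm x" using bop_le[OF Sbop] by blast
  have T: "T \<in> bop" unfolding bop_iff
  proof (intro conjI allI bounded_linear_intro[where K = "sqrt K"])
    show "T (x + y) = T x + T y" for x y
      by (simp add: fun_eq_iff Rep_T plus_l2.rep_eq bop_add[OF Bj] flip: Rep_l2_inject)
    show "T (c *\<^sub>C x) = c *\<^sub>C T x" for c x
      by (simp add: fun_eq_iff Rep_T scaleC_l2.rep_eq bop_scaleC[OF Bj] flip: Rep_l2_inject)
    then show "T (r *\<^sub>R x) = r *\<^sub>R T x" for r x
      by (simp add: scaleR_scaleC)
    show "norm (T x) \<le> norm x * sqrt K" for x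
    proof -
      have "(norm (T x))\<^sup>2 = inner (S x) x"
        unfolding norm_l2_power2 Rep_T by (rule infsumI[OF norm_sum])
      also have "\<dots> \<le> norm (S x) * norm x" by (rule norm_cauchy_schwarz)
      also have "\<dots> \<le> (K * norm x) * norm x" by (intro mult_right_mono K) simp
      also have "\<dots> = (norm x * sqrt K)\<^sup>2" using K by (simp add: power_mult_distrib power2_eq_square)
      finally show ?thesis by (rule power2_le_imp_le) (use K in simp)
    qed
  qed
  have op: "frame_op B x = adj T (T x)" for x
    unfolding frame_op_def by (subst (1 2) BT) (rule infsumI[OF has_sum_coordinates[OF T]])
  have "frame_op B = S" unfolding frame_op_def using infsumI[OF sum] by blast
  then show "invertible_on UNIV (frame_op B)" using S by simp
  show "analysis B \<in> bop" "B = (\<lambda>j. adj (coord_emb j) \<circ> analysis B)"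
    "frame_op B = adj (analysis B) \<circ> analysis B"
    unfolding aT using T BT op by (auto simp: fun_eq_iff)
qed

lemma inv_frame_op:
  assumes B: "B \<in> frames"
  shows "inv_on UNIV (frame_op B) \<in> bop"
    and "frame_op B (inv_on UNIV (frame_op B) x) = x"
    and "inv_on UNIV (frame_op B) (frame_op B x) = x"
    and "inner (inv_on UNIV (frame_op B) x) y = inner x (inv_on UNIV (frame_op B) y)"
proof -
  note inv = inv_on_UNIV[OF frame_analysis(4)[OF B]]
  show "inv_on UNIV (frame_op B) \<in> bop" "frame_op B (inv_on UNIV (frame_op B) x) = x"
    "inv_on UNIV (frame_op B) (frame_op B x) = x" by (fact inv)+
  have sym: "inner (frame_op B x) y = inner x (frame_op B y)" for x y
    using frame_analysis(1)[OF B]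
    by (simp add: frame_analysis(3)[OF B] inner_adj_left inner_adj_right[symmetric])
  show "inner (inv_on UNIV (frame_op B) x) y = inner x (inv_on UNIV (frame_op B) y)"
    using sym[of "inv_on UNIV (frame_op B) x" "inv_on UNIV (frame_op B) y"] by (simp add: inv)
qed

lemma adj_analysis_analysis:
  "B \<in> frames \<Longrightarrow> adj (analysis B) (analysis B x) = frame_op B x"
  by (simp add: frame_analysis(3))

lemma frame_proj_analysis:
  "A \<in> frames \<Longrightarrow> frame_proj A (analysis A x) = analysis A x"
  by (simp add: frame_proj_def adj_analysis_analysis inv_frame_op)

lemma adj_analysis_frame_proj:
  "A \<in> frames \<Longrightarrow> adj (analysis A) (frame_proj A f) = adj (analysis A) f"
  by (simp add: frame_proj_def adj_analysis_analysis inv_frame_op)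

lemma orth_proj_frame_proj:
  assumes A: "A \<in> frames"
  shows "orth_proj (frame_proj A)"
  unfolding orth_proj_def
proof (intro conjI allI)
  have T: "analysis A \<in> bop" by (rule frame_analysis(1)[OF A])
  show "frame_proj A \<in> bop"
    unfolding frame_proj_def by (intro bop_comp adj_bop T inv_frame_op(1)[OF A])
  show "frame_proj A (frame_proj A x) = frame_proj A x" for x
    by (simp add: frame_proj_def adj_analysis_analysis[OF A] inv_frame_op[OF A])
  show "inner (frame_proj A x) y = inner x (frame_proj A y)" for x y
    by (simp add: frame_proj_def inner_adj_right[OF T] inner_adj_left[OF T, symmetric]
        inv_frame_op(4)[OF A])
qed

section \<open>The parametrisation of frames\<close>

lemma frame_map_analysis:
  "A \<in> frames \<Longrightarrow> frame_map A B \<circ> analysis A = analysis B"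
  by (simp add: fun_eq_iff frame_map_def adj_analysis_analysis inv_frame_op)

text \<open>
  Besides the adjoint of \<open>M\<close>, the next lemma identifies the inverse of \<open>M\<^sup>* M\<close> on the range of the
  frame projection of \<open>A\<close>, extended by \<open>0\<close>, as the operator \<open>N\<close>.
\<close>

lemma frame_map_props:
  assumes A: "A \<in> frames" and B: "B \<in> frames"
  defines "M \<equiv> frame_map A B"
    and "N \<equiv> analysis A \<circ> inv_on UNIV (frame_op B) \<circ> adj (analysis A)"
  shows "M \<in> bop" "M (frame_proj A x) = M x"
    "adj M = analysis A \<circ> inv_on UNIV (frame_op A) \<circ> adj (analysis B)"
    "N \<in> bop_ext (range (frame_proj A))"
    "N (adj M (M x)) = frame_proj A x" "adj M (M (N x)) = frame_proj A x"
proof -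
  have a: "analysis A \<in> bop" and b: "analysis B \<in> bop"
    using frame_analysis(1) A B by auto
  show M: "M \<in> bop"
    unfolding M_def frame_map_def by (intro bop_comp adj_bop a b inv_frame_op(1)[OF A])
  show "M (frame_proj A x) = M x"
    by (simp add: M_def frame_map_def adj_analysis_frame_proj[OF A])
  show adjM: "adj M = analysis A \<circ> inv_on UNIV (frame_op A) \<circ> adj (analysis B)"
    by (rule adj_eqI[OF M])
      (simp add: M_def frame_map_def inner_adj_right[OF b] inner_adj_left[OF a, symmetric]
        inv_frame_op(4)[OF A])
  show "N \<in> bop_ext (range (frame_proj A))"
    unfolding bop_ext_range_iff[OF orth_proj_frame_proj[OF A]]
  proof (intro conjI allI)
    show "N \<in> bop" unfolding N_def by (intro bop_comp adj_bop a inv_frame_op(1)[OF B])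
  qed (simp_all add: N_def frame_proj_analysis[OF A] adj_analysis_frame_proj[OF A])
  show "N (adj M (M x)) = frame_proj A x" "adj M (M (N x)) = frame_proj A x"
    unfolding adjM
    by (simp_all add: N_def M_def frame_map_def frame_proj_def adj_analysis_analysis[OF A]
        adj_analysis_analysis[OF B] inv_frame_op[OF A] inv_frame_op[OF B])
qed

lemma frame_map_in_frame_params:
  assumes A: "A \<in> frames" and B: "B \<in> frames"
  shows "frame_map A B \<in> frame_params A"
proof -
  let ?M = "frame_map A B" and ?P = "frame_proj A"
  note P = orth_proj_frame_proj[OF A]
  note M = frame_map_props[OF A B]
  have PG: "?P (adj ?M (?M x)) = adj ?M (?M x)" for x
    by (simp add: M(3) frame_proj_analysis[OF A])
  let ?N = "analysis A \<circ> inv_on UNIV (frame_op B) \<circ> adj (analysis A)"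
  have "invertible_on (range ?P) (adj ?M \<circ> ?M)" unfolding invertible_on_def
  proof (intro conjI bexI[of _ ?N] ballI)
    show "adj ?M \<circ> ?M \<in> bop_on (range ?P) (range ?P)"
    proof (rule bop_on_UNIV_subset)
      show "(adj ?M \<circ> ?M) ` range ?P \<subseteq> range ?P"
        by (auto simp: orth_proj_mem_range[OF P] PG)
    qed (intro bop_comp adj_bop M(1))
    show "?N \<in> bop_on (range ?P) (range ?P)"
      by (rule bop_on_UNIV_subset) (use M(4) in \<open>simp_all add: bop_ext_def\<close>)
  next
    fix x assume "x \<in> range ?P"
    then have x: "?P x = x" by (simp only: orth_proj_mem_range[OF P])
    show "?N ((adj ?M \<circ> ?M) x) = x"
      using M(5)[of x] x by simp
    show "(adj ?M \<circ> ?M) (?N x) = x"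
      using M(6)[of x] x by simp
  qed
  then show ?thesis using M(1,2) by (simp add: frame_params_def fun_eq_iff)
qed

text \<open>Surjectivity: \<open>M\<close> is the image of the frame with analysis operator \<open>M T\<^sub>A\<close>.\<close>

lemma frame_of_param:
  assumes A: "A \<in> frames" and M: "M \<in> frame_params A"
  defines "B \<equiv> (\<lambda>j. adj (coord_emb j) \<circ> (M \<circ> analysis A))"
  shows "B \<in> frames" "frame_map A B = M"
proof -
  let ?P = "frame_proj A" and ?T = "analysis A" and ?S = "inv_on UNIV (frame_op A)"
  note P = orth_proj_frame_proj[OF A]
  have Pbop: "?P \<in> bop" using P by (simp add: orth_proj_def)
  have a: "?T \<in> bop" by (rule frame_analysis(1)[OF A])
  have Mbop: "M \<in> bop" and "M = M \<circ> ?P" and inv: "invertible_on (range ?P) (adj M \<circ> M)"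
    using M by (simp_all add: frame_params_def)
  then have MP: "M (?P x) = M x" for x by (metis comp_apply)
  from inv obtain N where N: "N \<in> bop_on (range ?P) (range ?P)"
    and NG: "\<And>x. N (adj M (M (?P x))) = ?P x" and GN: "\<And>x. adj M (M (N (?P x))) = ?P x"
    and G: "adj M \<circ> M \<in> bop_on (range ?P) (range ?P)"
    unfolding invertible_on_def by auto
  have "?P (adj M (M (?P x))) = adj M (M (?P x))" for x
    using G by (auto simp: bop_on_def simp flip: orth_proj_mem_range[OF P])
  then have PG: "?P (adj M (M x)) = adj M (M x)" for x by (simp add: MP)
  \<comment> \<open>\<open>N\<close> is constrained only on the range of the projection; \<open>N0\<close> extends it by \<open>0\<close>\<close>
  define N0 where "N0 x = N (?P x)" for x
  have N0: "N0 \<in> bop"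
  proof -
    obtain K where K: "\<forall>x\<in>range ?P. norm (N x) \<le> K * norm x" using N by (auto simp: bop_on_def)
    obtain K' where K': "K' > 0" "\<And>x. norm (?P x) \<le> K' * norm x" using bop_le[OF Pbop] by blast
    have "norm (N0 x) \<le> (\<bar>K\<bar> * K') * norm x" for x
    proof -
      have "norm (N0 x) \<le> K * norm (?P x)" using K by (simp add: N0_def)
      also have "\<dots> \<le> \<bar>K\<bar> * norm (?P x)" by (intro mult_right_mono) auto
      also have "\<dots> \<le> \<bar>K\<bar> * (K' * norm x)" by (intro mult_left_mono K') auto
      finally show ?thesis by (simp add: mult_ac)
    qed
    then show ?thesis using N
      by (auto simp: bop_on_def N0_def bop_add[OF Pbop] bop_scaleC[OF Pbop])
  qed
  have T: "M \<circ> ?T \<in> bop" by (rule bop_comp[OF Mbop a])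
  have adjT: "adj (M \<circ> ?T) = adj ?T \<circ> adj M" by (rule adj_comp[OF Mbop a])
  have TST: "?T (?S (adj ?T f)) = ?P f" for f by (simp add: frame_proj_def)
  let ?W = "?S \<circ> adj ?T \<circ> N0 \<circ> ?T \<circ> ?S"
  have "invertible_on UNIV (adj (M \<circ> ?T) \<circ> (M \<circ> ?T))" unfolding invertible_on_def
  proof (intro conjI bexI[of _ ?W] ballI)
    show "adj (M \<circ> ?T) \<circ> (M \<circ> ?T) \<in> bop" by (intro bop_comp[OF adj_bop] T)
    show "?W \<in> bop" by (intro bop_comp inv_frame_op(1)[OF A] adj_bop a N0)
    show "?W ((adj (M \<circ> ?T) \<circ> (M \<circ> ?T)) x) = x" for x
    proof -
      have "N0 (adj M (M (?T x))) = ?T x"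
        using NG[of "?T x"] by (simp add: N0_def PG MP frame_proj_analysis[OF A])
      then show ?thesis
        by (simp add: adjT TST PG adj_analysis_analysis[OF A] inv_frame_op[OF A])
    qed
    show "(adj (M \<circ> ?T) \<circ> (M \<circ> ?T)) (?W x) = x" for x
    proof -
      have "adj M (M (N0 (?T (?S x)))) = ?T (?S x)"
        using GN[of "?T (?S x)"] by (simp add: N0_def frame_proj_analysis[OF A])
      then show ?thesis
        by (simp add: adjT TST MP adj_analysis_analysis[OF A] inv_frame_op[OF A])
    qed
  qed
  then show "B \<in> frames" unfolding B_def by (rule coordinates_frame[OF T])
  have "analysis B = M \<circ> ?T" unfolding B_def by (rule analysis_coordinates)
  then show "frame_map A B = M" by (simp add: fun_eq_iff frame_map_def TST MP)
qed

theorem theorem3p1: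
  fixes A :: "('j, 'h :: chilbert_space, 'k :: chilbert_space) op_family"
  assumes "A \<in> frames"
  shows "bij_betw (frame_map A) frames (frame_params A)
    \<and> (\<forall>M \<in> frame_params A.
         inv_into frames (frame_map A) M = (\<lambda>j. adj (coord_emb j) \<circ> M \<circ> analysis A))
    \<and> (\<forall>B \<in> frames. \<forall>M. M = frame_map A B \<longrightarrow>
         analysis B = M \<circ> analysis A
         \<and> partial_isometry (polar_part A M)
         \<and> frame_proj B = polar_part A M \<circ> adj (polar_part A M)
         \<and> frame_proj A = adj (polar_part A M) \<circ> polar_part A M)"
proof -
  note A = assms
  have inj: "inj_on (frame_map A) frames"
  proof (rule inj_onI)
    fix B C assume B: "B \<in> frames" and C: "C \<in> frames" and eq: "frame_map A B = frame_map A C"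
    have "analysis B = analysis C"
      using frame_map_analysis[OF A, of B] frame_map_analysis[OF A, of C] eq by simp
    then show "B = C" using frame_analysis(2)[OF B] frame_analysis(2)[OF C] by simp
  qed
  have "frame_map A ` frames = frame_params A"
    using frame_map_in_frame_params[OF A] frame_of_param[OF A] by (blast intro: sym)
  then have bij: "bij_betw (frame_map A) frames (frame_params A)"
    using inj by (simp add: bij_betw_def)
  have inverse: "inv_into frames (frame_map A) M = (\<lambda>j. adj (coord_emb j) \<circ> M \<circ> analysis A)"
    if "M \<in> frame_params A" for M
    using inv_into_f_f[OF inj frame_of_param(1)[OF A that]]
    unfolding frame_of_param(2)[OF A that] by (simp add: o_assoc)
  have "partial_isometry (polar_part A M)" "adj (polar_part A M) \<circ> polar_part A M = frame_proj A"
    "polar_part A M \<circ> adj (polar_part A M) = frame_proj B"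
    if B: "B \<in> frames" and M: "M = frame_map A B" for B M
  proof -
    note props = frame_map_props[OF A B, folded M]
    note polar = polar_part_of_invertible[OF orth_proj_frame_proj[OF A] props(1,2,4,5,6)]
    have V: "polar_part A M
        = M \<circ> sqrt_on (range (frame_proj A)) (inv_on (range (frame_proj A)) (adj M \<circ> M))"
      by (simp add: polar_part_def Let_def)
    show "partial_isometry (polar_part A M)" "adj (polar_part A M) \<circ> polar_part A M = frame_proj A"
      unfolding V by (fact polar)+
    have "polar_part A M \<circ> adj (polar_part A M)
        = M \<circ> (analysis A \<circ> inv_on UNIV (frame_op B) \<circ> adj (analysis A)) \<circ> adj M"
      unfolding V by (fact polar(3))
    also have "\<dots> = frame_proj B"
      unfolding props(3)
      by (simp add: fun_eq_iff M frame_map_def frame_proj_def adj_analysis_analysis[OF A]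
          inv_frame_op[OF A])
    finally show "polar_part A M \<circ> adj (polar_part A M) = frame_proj B" .
  qed
  then show ?thesis using bij inverse frame_map_analysis[OF A] by auto
qed

end
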